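(* Let $\mathbb Q_{a,b,c}=\{\frac{x^2}{a}+\frac{y^2}{b}+\frac{z^2}{c}=1\}$ be an ellipsoid or a hyperboloid of one or two sheets. The ridge set of $\mathbb Q_{a,b,c}$ is (away from the umbilic points) the intersection of the quadric with the coordinate planes. Moreover: a) For the ellipsoid with $0<c<b<a$: i) the ellipse $E_{xy}=\{z=0\}\cap\mathbb Q_{a,b,c}$ (resp. $E_{yz}=\{x=0\}\cap\mathbb Q_{a,b,c}$) is a ridge corresponding to $k_2$ (resp. $k_1$), and is zigzag; ii) the ellipse $E_{xz}=\{y=0\}\cap\mathbb Q_{a,b,c}$, containing the four umbilic points $(\pm x_0,0,\pm z_0)$, is the union of ridges of $k_1$ and $k_2$; for $|x|>x_0$ the ridge corresponds to $k_1$; the ellipse $E_{xz}$ is beak to beak in both cases. b) For the hyperboloid of one sheet with $c<0<b<a$: i) the hyperbola $H_{yz}=\{x=0\}\cap\mathbb Q_{a,b,c}$ is a ridge corresponding to $k_1$ and is beak to beak; ii) the hyperbola $H_{xz}=\{y=0\}\cap\mathbb Q_{a,b,c}$ is a ridge corresponding to $k_1$ and is zigzag; iii) the ellipse $E_{xy}=\{z=0\}\cap\mathbb Q_{a,b,c}$ is a ridge corresponding to $k_2$ and is zigzag. c) For the hyperboloid of two sheets with $c<b<0<a$: i) the hyperbola $H_{xz}=\{y=0\}\cap\mathbb Q_{a,b,c}$ is a ridge corresponding to $k_1$ and is zigzag; ii) the hyperbola $H_{xy}=\{z=0\}\cap\mathbb Q_{a,b,c}$, containing the four umbilic points $(\pm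 x_0,\pm y_0,0)$, is the union of ridges of $k_1$ and $k_2$; for $|x|>x_0$ the ridge corresponds to $k_1$; all segments of the hyperbola are beak to beak.
   Context: Principal chart: $(x,y,z)=\left(\pm\sqrt{\frac{a(u-a)(v-a)}{(b-a)(c-a)}},\pm\sqrt{\frac{b(u-b)(v-b)}{(b-a)(b-c)}},\pm\sqrt{\frac{c(u-c)(v-c)}{(c-a)(c-b)}}\right)$, with $u\in(b,a)$, $v\in(c,b)$ (ellipsoid); $u\in(b,a)$, $v<c$ (one sheet); $u\in(c,b)$, $v<c$ (two sheets). Principal curvatures: $k_1=\frac1u\sqrt{\frac{abc}{uv}}$ (along $v=$ const) and $k_2=\frac1v\sqrt{\frac{abc}{uv}}$ (along $u=$ const), up to a global choice of normal; they extend continuously to the whole quadric. In a principal chart $(u,v)$ (a regular one, near the point considered) a non-umbilic point is a ridge point corresponding to $k_1$ if $\partial k_1/\partial u=0$ there, and to $k_2$ if $\partial k_2/\partial v=0$. A ridge point for $k_1$ is zigzag (resp. beak to beak) if $\sigma_1=\frac{\partial^2k_1}{\partial u^2}/(k_1-k_2)$ is $<0$ (resp. $>0$); a ridge point for $k_2$ is zigzag (resp. beak to beak) if $\sigma_2=\frac{\partial^2k_2}{\partial v^2}/(k_2-k_1)$ is $<0$ (resp. $>0$). These signs do not depend on the regular principal chart. For the ellipsoid $x_0=\sqrt{\frac{a(a-b)}{a-c}}$, $z_0=\sqrt{\frac{c(b-c)}{a-c}}$; for the hyperboloid of two sheets $(\pm x_0,\pm y_0,0)$ denote its umbilic points. 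*)

theory Defs
  imports "HOL-Analysis.Analysis"
begin

definition quadric :: "real \<Rightarrow> real \<Rightarrow> real \<Rightarrow> (real^3) set" where
  "quadric a b c = {p. (p$1)\<^sup>2 / a + (p$2)\<^sup>2 / b + (p$3)\<^sup>2 / c = 1}"

definition is_ellipsoid :: "real \<Rightarrow> real \<Rightarrow> real \<Rightarrow> bool" where
  "is_ellipsoid a b c \<longleftrightarrow> 0 < c \<and> c < b \<and> b < a"

definition is_one_sheet :: "real \<Rightarrow> real \<Rightarrow> real \<Rightarrow> bool" where
  "is_one_sheet a b c \<longleftrightarrow> c < 0 \<and> 0 < b \<and> b < a"

definition is_two_sheets :: "real \<Rightarrow> real \<Rightarrow> real \<Rightarrow> bool" where
  "is_two_sheets a b c \<longleftrightarrow> c < b \<and> b < 0 \<and> 0 < a"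

text \<open>The explicit principal charts, one for each choice of signs; together they
  cover the points of the quadric off the coordinate planes.\<close>

definition confocal_dom :: "real \<Rightarrow> real \<Rightarrow> real \<Rightarrow> (real \<times> real) set" where
  "confocal_dom a b c =
     (if is_ellipsoid a b c then {b<..<a} \<times> {c<..<b}
      else if is_one_sheet a b c then {b<..<a} \<times> {..<c}
      else if is_two_sheets a b c then {c<..<b} \<times> {..<c}
      else {})"

definition confocal_chart ::
  "real \<Rightarrow> real \<Rightarrow> real \<Rightarrow> real \<times> real \<times> real \<Rightarrow> real \<times> real \<Rightarrow> real^3" where
  "confocal_chart a b c = (\<lambda>(s1, s2, s3) (u, v). vector
     [s1 * sqrt (a * (u - a) * (v - a) / ((b - a) * (c - a))),
      s2 * sqrt (b * (u - b) * (v - b) / ((b - a) * (b - c))),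
      s3 * sqrt (c * (u - c) * (v - c) / ((c - a) * (c - b)))])"

text \<open>A function of the parameters \<open>(u, v)\<close>, read on the quadric through the charts above
  and extended continuously to the whole quadric. The extension is unique because the images
  of the charts are dense in the quadric; the value 0 off the quadric is a convention that
  makes the description definite.\<close>

definition quadric_ext ::
  "real \<Rightarrow> real \<Rightarrow> real \<Rightarrow> (real \<times> real \<Rightarrow> real) \<Rightarrow> real^3 \<Rightarrow> real" where
  "quadric_ext a b c \<kappa> = (THE k.
     continuous_on (quadric a b c) k \<and>
     (\<forall>p. p \<notin> quadric a b c \<longrightarrow> k p = 0) \<and>
     (\<forall>s \<in> {-1, 1} \<times> {-1, 1} \<times> {-1, 1}. \<forall>q \<in> confocal_dom a b c.
        k (confocal_chart a b c s q) = \<kappa> q))"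

definition curv1 :: "real \<Rightarrow> real \<Rightarrow> real \<Rightarrow> real^3 \<Rightarrow> real" where
  "curv1 a b c = quadric_ext a b c (\<lambda>(u, v). 1 / u * sqrt (a * b * c / (u * v)))"

definition curv2 :: "real \<Rightarrow> real \<Rightarrow> real \<Rightarrow> real^3 \<Rightarrow> real" where
  "curv2 a b c = quadric_ext a b c (\<lambda>(u, v). 1 / v * sqrt (a * b * c / (u * v)))"

definition umbilics :: "real \<Rightarrow> real \<Rightarrow> real \<Rightarrow> (real^3) set" where
  "umbilics a b c = {p \<in> quadric a b c. curv1 a b c p = curv2 a b c p}"

text \<open>The choice of unit normal, opposite to the gradient of the defining equation, for which
  the principal curvatures are \<open>curv1\<close> and \<open>curv2\<close> with the signs above.\<close>

definition unit_normal :: "real \<Rightarrow> real \<Rightarrow> real \<Rightarrow> real^3 \<Rightarrow> real^3" where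
  "unit_normal a b c p = - sgn (vector [p$1 / a, p$2 / b, p$3 / c])"

definition du :: "(real \<times> real \<Rightarrow> 'a::real_normed_vector) \<Rightarrow> real \<times> real \<Rightarrow> 'a" where
  "du f q = vector_derivative (\<lambda>t. f (t, snd q)) (at (fst q))"

definition dv :: "(real \<times> real \<Rightarrow> 'a::real_normed_vector) \<Rightarrow> real \<times> real \<Rightarrow> 'a" where
  "dv f q = vector_derivative (\<lambda>t. f (fst q, t)) (at (snd q))"

primrec Ck_on :: "nat \<Rightarrow> (real \<times> real) set \<Rightarrow> (real \<times> real \<Rightarrow> 'a::real_normed_vector) \<Rightarrow> bool" where
  "Ck_on 0 D f \<longleftrightarrow> continuous_on D f"
| "Ck_on (Suc k) D f \<longleftrightarrow> f differentiable_on D \<and> Ck_on k D (du f) \<and> Ck_on k D (dv f)"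

definition smooth2_on :: "(real \<times> real) set \<Rightarrow> (real \<times> real \<Rightarrow> 'a::real_normed_vector) \<Rightarrow> bool" where
  "smooth2_on D f \<longleftrightarrow> (\<forall>k. Ck_on k D f)"

text \<open>A regular principal chart: an injective smooth immersion of an open set into the quadric
  whose coordinate curves are lines of curvature, those with \<open>v\<close> constant belonging to
  \<open>curv1\<close> and those with \<open>u\<close> constant to \<open>curv2\<close>. The last two conditions say
  that the partial derivatives of the chart are eigenvectors of the shape operator (minus the
  differential of the unit normal). As the quadric is a regular surface, such a map is
  automatically a homeomorphism onto an open subset of it.\<close>

definition principal_chart ::
  "real \<Rightarrow> real \<Rightarrow> real \<Rightarrow> (real \<times> real) set \<Rightarrow> (real \<times> real \<Rightarrow> real^3) \<Rightarrow> bool" where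
  "principal_chart a b c D \<psi> \<longleftrightarrow>
     open D \<and> smooth2_on D \<psi> \<and> inj_on \<psi> D \<and> \<psi> ` D \<subseteq> quadric a b c \<and>
     (\<forall>q \<in> D. cross3 (du \<psi> q) (dv \<psi> q) \<noteq> 0 \<and>
        - du (unit_normal a b c \<circ> \<psi>) q = curv1 a b c (\<psi> q) *\<^sub>R du \<psi> q \<and>
        - dv (unit_normal a b c \<circ> \<psi>) q = curv2 a b c (\<psi> q) *\<^sub>R dv \<psi> q)"

definition principal_chart_at ::
  "real \<Rightarrow> real \<Rightarrow> real \<Rightarrow> real^3 \<Rightarrow> (real \<times> real \<Rightarrow> real^3) \<Rightarrow> real \<times> real \<Rightarrow> bool" where
  "principal_chart_at a b c p \<psi> q \<longleftrightarrow> (\<exists>D. principal_chart a b c D \<psi> \<and> q \<in> D \<and> \<psi> q = p)"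

definition ridge1 :: "real \<Rightarrow> real \<Rightarrow> real \<Rightarrow> (real^3) set" where
  "ridge1 a b c = {p \<in> quadric a b c - umbilics a b c.
     \<exists>\<psi> q. principal_chart_at a b c p \<psi> q \<and> du (curv1 a b c \<circ> \<psi>) q = 0}"

definition ridge2 :: "real \<Rightarrow> real \<Rightarrow> real \<Rightarrow> (real^3) set" where
  "ridge2 a b c = {p \<in> quadric a b c - umbilics a b c.
     \<exists>\<psi> q. principal_chart_at a b c p \<psi> q \<and> dv (curv2 a b c \<circ> \<psi>) q = 0}"

definition ridge_set :: "real \<Rightarrow> real \<Rightarrow> real \<Rightarrow> (real^3) set" where
  "ridge_set a b c = ridge1 a b c \<union> ridge2 a b c"

definition sigma1 ::
  "real \<Rightarrow> real \<Rightarrow> real \<Rightarrow> (real \<times> real \<Rightarrow> real^3) \<Rightarrow> real \<times> real \<Rightarrow> real" where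
  "sigma1 a b c \<psi> q =
     du (du (curv1 a b c \<circ> \<psi>)) q / (curv1 a b c (\<psi> q) - curv2 a b c (\<psi> q))"

definition sigma2 ::
  "real \<Rightarrow> real \<Rightarrow> real \<Rightarrow> (real \<times> real \<Rightarrow> real^3) \<Rightarrow> real \<times> real \<Rightarrow> real" where
  "sigma2 a b c \<psi> q =
     dv (dv (curv2 a b c \<circ> \<psi>)) q / (curv2 a b c (\<psi> q) - curv1 a b c (\<psi> q))"

text \<open>The sign conditions are imposed in every regular principal chart near the point; they are
  not vacuous, since a ridge point has such a chart.\<close>

definition zigzag1 :: "real \<Rightarrow> real \<Rightarrow> real \<Rightarrow> (real^3) set" where
  "zigzag1 a b c = {p \<in> ridge1 a b c.
     \<forall>\<psi> q. principal_chart_at a b c p \<psi> q \<longrightarrow> sigma1 a b c \<psi> q < 0}"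

definition beak_to_beak1 :: "real \<Rightarrow> real \<Rightarrow> real \<Rightarrow> (real^3) set" where
  "beak_to_beak1 a b c = {p \<in> ridge1 a b c.
     \<forall>\<psi> q. principal_chart_at a b c p \<psi> q \<longrightarrow> sigma1 a b c \<psi> q > 0}"

definition zigzag2 :: "real \<Rightarrow> real \<Rightarrow> real \<Rightarrow> (real^3) set" where
  "zigzag2 a b c = {p \<in> ridge2 a b c.
     \<forall>\<psi> q. principal_chart_at a b c p \<psi> q \<longrightarrow> sigma2 a b c \<psi> q < 0}"

definition beak_to_beak2 :: "real \<Rightarrow> real \<Rightarrow> real \<Rightarrow> (real^3) set" where
  "beak_to_beak2 a b c = {p \<in> ridge2 a b c.
     \<forall>\<psi> q. principal_chart_at a b c p \<psi> q \<longrightarrow> sigma2 a b c \<psi> q > 0}"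

definition sec_xy :: "real \<Rightarrow> real \<Rightarrow> real \<Rightarrow> (real^3) set" where
  "sec_xy a b c = {p \<in> quadric a b c. p$3 = 0}"

definition sec_xz :: "real \<Rightarrow> real \<Rightarrow> real \<Rightarrow> (real^3) set" where
  "sec_xz a b c = {p \<in> quadric a b c. p$2 = 0}"

definition sec_yz :: "real \<Rightarrow> real \<Rightarrow> real \<Rightarrow> (real^3) set" where
  "sec_yz a b c = {p \<in> quadric a b c. p$1 = 0}"

end

theory Submission
  imports Defs
begin

text \<open>
  On the quadric the confocal coordinates \<open>u\<close> and \<open>v\<close> are the roots of
  \<open>t\<^sup>2 - S t + P\<close>, where \<open>S = a + b + c - |p|\<^sup>2\<close> and
  \<open>P = a b c |g|\<^sup>2\<close> with \<open>g = (x/a, y/b, z/c)\<close>; at \<open>t = a\<^sub>i\<close> this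
  polynomial takes the value \<open>M\<^sub>i x\<^sub>i\<^sup>2\<close>. The curvatures are
  \<open>1 / (u |g|)\<close> and \<open>1 / (v |g|)\<close>. If a curve in the quadric has velocity \<open>w\<close> that is
  an eigenvector of the shape operator for \<open>k\<^sub>1\<close>, then
  \<open>w\<^sub>i (u - a\<^sub>i) = \<tau> x\<^sub>i\<close> with \<open>\<tau> = - p \<bullet> w\<close>, hence
  \<open>u' = 2 \<tau>\<close>, \<open>v' = 0\<close> and \<open>k\<^sub>1' = - 3 \<tau> k\<^sub>1 / u\<close>. So, in every principal
  chart, ridge points of \<open>k\<^sub>1\<close> are the points with \<open>\<tau> = 0\<close>, which means \<open>u = a\<^sub>i\<close>
  for some \<open>i\<close>. Differentiating \<open>(u - a\<^sub>i) (v - a\<^sub>i) = M\<^sub>i x\<^sub>i\<^sup>2\<close> expresses \<open>\<tau>\<close> near such a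
  point, and \<open>\<sigma>\<^sub>1\<close> turns out to be a negative multiple of \<open>M\<^sub>i a\<^sub>i v\<close>, so that
  all three kinds of quadrics reduce to reading off signs. The roles of \<open>u\<close> and \<open>v\<close> are exchanged
  by the sign in front of the square root of the discriminant. Regular principal charts at
  a non-umbilic point have components \<open>\<alpha>\<^sub>i(s) \<beta>\<^sub>i(t)\<close>, where \<open>\<alpha>\<^sub>i\<^sup>2\<close> and \<open>\<beta>\<^sub>i\<^sup>2\<close> are
  constant multiples of \<open>u - a\<^sub>i\<close> and \<open>v - a\<^sub>i\<close>.
\<close>

subsection \<open>Derivatives along coordinate lines and smooth product maps\<close>

lemma inner_has_real_derivative:
  fixes f g :: "real \<Rightarrow> 'a::real_inner"
  assumes "(f has_vector_derivative f') (at t)" "(g has_vector_derivative g') (at t)"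
  shows "((\<lambda>s. f s \<bullet> g s) has_real_derivative f t \<bullet> g' + f' \<bullet> g t) (at t)"
  using bounded_bilinear.has_vector_derivative[OF bounded_bilinear_inner assms]
  by (simp add: has_real_derivative_iff_has_vector_derivative)

lemma isCont_eventually_neq:
  fixes f :: "'a::t2_space \<Rightarrow> 'b::t1_space"
  assumes "isCont f t" "f t \<noteq> y"
  shows "eventually (\<lambda>s. f s \<noteq> y) (nhds t)"
  using assms tendsto_imp_eventually_ne[of f "f t" "nhds t" y]
  by (simp add: isCont_def tendsto_at_iff_tendsto_nhds)

lemma slice_fst_eventually:
  assumes "open D" "q \<in> D"
  shows "eventually (\<lambda>s. (s, snd q) \<in> D) (nhds (fst q))"
proof -
  have "((\<lambda>s. (s, snd q)) \<longlongrightarrow> (fst q, snd q)) (nhds (fst q))"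
    by (intro tendsto_Pair tendsto_const) (simp add: filterlim_ident)
  from topological_tendstoD[OF this assms(1)] assms(2) show ?thesis by simp
qed

lemma slice_snd_eventually:
  assumes "open D" "q \<in> D"
  shows "eventually (\<lambda>s. (fst q, s) \<in> D) (nhds (snd q))"
proof -
  have "((\<lambda>s. (fst q, s)) \<longlongrightarrow> (fst q, snd q)) (nhds (snd q))"
    by (intro tendsto_Pair tendsto_const) (simp add: filterlim_ident)
  from topological_tendstoD[OF this assms(1)] assms(2) show ?thesis by simp
qed

lemma slice_fst_has_vector_derivative:
  assumes "\<psi> differentiable_on D" "open D" "(s, y) \<in> D"
  shows "((\<lambda>t. \<psi> (t, y)) has_vector_derivative du \<psi> (s, y)) (at s)"
proof -
  have "\<psi> differentiable at (s, y)"
    using assms differentiable_on_eq_differentiable_at by blast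
  moreover have "(\<lambda>t. (t, y)) differentiable at s"
    by (auto intro!: derivative_eq_intros simp: differentiable_def)
  ultimately have "(\<lambda>t. \<psi> (t, y)) differentiable at s"
    using differentiable_chain_at[of "\<lambda>t. (t, y)" s \<psi>] by (simp add: o_def)
  then show ?thesis by (simp add: vector_derivative_works du_def)
qed

lemma slice_snd_has_vector_derivative:
  assumes "\<psi> differentiable_on D" "open D" "(x, s) \<in> D"
  shows "((\<lambda>t. \<psi> (x, t)) has_vector_derivative dv \<psi> (x, s)) (at s)"
proof -
  have "\<psi> differentiable at (x, s)"
    using assms differentiable_on_eq_differentiable_at by blast
  moreover have "(\<lambda>t. (x, t)) differentiable at s"
    by (auto intro!: derivative_eq_intros simp: differentiable_def)
  ultimately have "(\<lambda>t. \<psi> (x, t)) differentiable at s"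
    using differentiable_chain_at[of "\<lambda>t. (x, t)" s \<psi>] by (simp add: o_def)
  then show ?thesis by (simp add: vector_derivative_works dv_def)
qed

lemma vector_derivative_cong_nhds:
  assumes "eventually (\<lambda>s. f s = g s) (nhds t)"
  shows "vector_derivative f (at t) = vector_derivative g (at t)"
  using assms by (intro vector_derivative_cong_eq) auto

section \<open>Real functions of class C^n\<close>

text \<open>The derivative is an existential witness, so closure proofs can name an explicit formula
  for it. It is a two-sided derivative at each point of \<open>S\<close>, even a boundary
  point.\<close>

primrec Cn_on :: "nat \<Rightarrow> real set \<Rightarrow> (real \<Rightarrow> real) \<Rightarrow> bool" where
  "Cn_on 0 S f \<longleftrightarrow> continuous_on S f"
| "Cn_on (Suc n) S f \<longleftrightarrow> (\<exists>f'. (\<forall>x\<in>S. (f has_real_derivative f' x) (at x)) \<and> Cn_on n S f')"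

lemma Cn_on_SucD: "Cn_on (Suc n) S f \<Longrightarrow> Cn_on n S f"
proof (induction n arbitrary: f)
  case 0
  then show ?case
    by (auto intro!: continuous_at_imp_continuous_on dest: DERIV_isCont)
next
  case (Suc n)
  then obtain f' where "\<forall>x\<in>S. (f has_real_derivative f' x) (at x)" "Cn_on (Suc n) S f'"
    by auto
  with Suc.IH[of f'] show ?case by auto
qed

lemma Cn_on_const: "Cn_on n S (\<lambda>x. k)"
proof (induction n arbitrary: k)
  case (Suc n)
  show ?case by (auto intro!: exI[of _ "\<lambda>x. 0"] Suc)
qed simp

lemma Cn_on_ident: "Cn_on n S (\<lambda>x. x)"
proof (cases n)
  case (Suc m)
  then show ?thesis by (auto intro!: exI[of _ "\<lambda>x. 1"] Cn_on_const)
qed simp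

lemma Cn_on_add: "Cn_on n S f \<Longrightarrow> Cn_on n S g \<Longrightarrow> Cn_on n S (\<lambda>x. f x + g x)"
proof (induction n arbitrary: f g)
  case 0
  then show ?case by (simp add: continuous_on_add)
next
  case (Suc n)
  then obtain f' g' where "\<forall>x\<in>S. (f has_real_derivative f' x) (at x)" "Cn_on n S f'"
    "\<forall>x\<in>S. (g has_real_derivative g' x) (at x)" "Cn_on n S g'"
    by auto
  with Suc.IH[of f' g'] show ?case by (auto intro!: exI[of _ "\<lambda>x. f' x + g' x"] DERIV_add)
qed

lemma Cn_on_mult: "Cn_on n S f \<Longrightarrow> Cn_on n S g \<Longrightarrow> Cn_on n S (\<lambda>x. f x * g x)"
proof (induction n arbitrary: f g)
  case 0
  then show ?case by (simp add: continuous_on_mult)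
next
  case (Suc n)
  then obtain f' g' where d: "\<forall>x\<in>S. (f has_real_derivative f' x) (at x)" "Cn_on n S f'"
    "\<forall>x\<in>S. (g has_real_derivative g' x) (at x)" "Cn_on n S g'"
    by auto
  have "Cn_on n S (\<lambda>x. f' x * g x + g' x * f x)"
    using Suc.IH Suc.prems[THEN Cn_on_SucD] d by (intro Cn_on_add) auto
  with d show ?case by (auto intro!: exI[of _ "\<lambda>x. f' x * g x + g' x * f x"] DERIV_mult)
qed

text \<open>With r the inverse square root of f, r' = - f' r^3 / 2, so the derivative is again a
  product of r and f' and the induction on \<open>n\<close> closes. This is not so for the square
  root, whose derivative involves r; hence r comes first.\<close>

lemma Cn_on_inverse_sqrt:
  "Cn_on n S f \<Longrightarrow> (\<And>x. x \<in> S \<Longrightarrow> f x > 0) \<Longrightarrow> Cn_on n S (\<lambda>x. inverse (sqrt (f x)))"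
proof (induction n)
  case 0
  then show ?case by (auto intro!: continuous_intros simp: less_imp_neq[THEN not_sym])
next
  case (Suc n)
  let ?r = "\<lambda>x. inverse (sqrt (f x))"
  obtain f' where f': "\<forall>x\<in>S. (f has_real_derivative f' x) (at x)" "Cn_on n S f'"
    using Suc.prems by auto
  have "Cn_on n S ?r" using Suc Cn_on_SucD by blast
  then have "Cn_on n S (\<lambda>x. - (1 / 2) * (f' x * (?r x * (?r x * ?r x))))"
    using f'(2) by (intro Cn_on_mult Cn_on_const)
  moreover have "(?r has_real_derivative - (1 / 2) * (f' x * (?r x * (?r x * ?r x)))) (at x)" if "x \<in> S" for x
    using f'(1) Suc.prems(2)[OF that] that
    by (auto intro!: derivative_eq_intros simp: field_simps)
  ultimately show ?case
    by (auto intro!: exI[of _ "\<lambda>x. - (1 / 2) * (f' x * (?r x * (?r x * ?r x)))"])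
qed

lemma Cn_on_sqrt:
  assumes "Cn_on n S f" "\<And>x. x \<in> S \<Longrightarrow> f x > 0"
  shows "Cn_on n S (\<lambda>x. sqrt (f x))"
proof (cases n)
  case 0
  then show ?thesis using assms(1) by (auto intro!: continuous_intros)
next
  case (Suc m)
  then obtain f' where f': "\<forall>x\<in>S. (f has_real_derivative f' x) (at x)" "Cn_on m S f'"
    using assms(1) by auto
  have 1: "Cn_on m S (\<lambda>x. 1 / 2 * (f' x * inverse (sqrt (f x))))"
    using f'(2) Cn_on_inverse_sqrt[of m S f] assms Cn_on_SucD
    by (intro Cn_on_mult Cn_on_const) (auto simp: Suc)
  have 2: "((\<lambda>x. sqrt (f x)) has_real_derivative 1 / 2 * (f' x * inverse (sqrt (f x)))) (at x)" if "x \<in> S" for x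
    using DERIV_chain2[OF DERIV_real_sqrt f'(1)[rule_format, OF that]] assms(2)[OF that]
    by (simp add: mult_ac)
  show ?thesis
    unfolding Suc Cn_on.simps
    by (rule exI[of _ "\<lambda>x. 1 / 2 * (f' x * inverse (sqrt (f x)))"]) (intro conjI ballI 1 2)
qed

section \<open>Vector-valued maps of two variables and separated products\<close>

lemma has_derivative_vec_lambda:
  fixes f :: "'n::finite \<Rightarrow> 'a::real_normed_vector \<Rightarrow> real"
  assumes "\<And>i. (f i has_derivative f' i) (at x within S)"
  shows "((\<lambda>x. \<chi> i. f i x) has_derivative (\<lambda>h. \<chi> i. f' i h)) (at x within S)"
proof (subst has_derivative_componentwise_within, rule ballI)
  fix b :: "real^'n" assume "b \<in> Basis"
  then obtain i where b: "b = axis i 1" by (auto simp: Basis_vec_def)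
  show "((\<lambda>x. (\<chi> i. f i x) \<bullet> b) has_derivative (\<lambda>h. (\<chi> i. f' i h) \<bullet> b)) (at x within S)"
    using assms[of i] by (simp add: b inner_axis)
qed

text \<open>Partial derivatives at a point of an open set depend only on nearby values, so agreement
  on \<open>D\<close> passes to \<open>du\<close> and \<open>dv\<close> and the induction on the
  order goes through.\<close>

lemma Ck_on_cong:
  assumes "open D" "\<And>q. q \<in> D \<Longrightarrow> f q = g q" "Ck_on n D f"
  shows "Ck_on n D g"
  using assms(2,3)
proof (induction n arbitrary: f g)
  case 0
  then show ?case by (auto intro: continuous_on_eq)
next
  case (Suc n)
  have "du f q = du g q" if "q \<in> D" for q
    unfolding du_def
    by (rule vector_derivative_cong_nhds)
      (rule eventually_mono[OF slice_fst_eventually[OF assms(1) that]], use Suc.prems in blast)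
  moreover have "dv f q = dv g q" if "q \<in> D" for q
    unfolding dv_def
    by (rule vector_derivative_cong_nhds)
      (rule eventually_mono[OF slice_snd_eventually[OF assms(1) that]], use Suc.prems in blast)
  moreover have "g differentiable_on D"
    using Suc.prems unfolding differentiable_on_def
    by (metis Ck_on.simps(2) differentiable_on_def differentiable_transform_within zero_less_one)
  ultimately show ?case
    using Suc.prems Suc.IH[of "du f" "du g"] Suc.IH[of "dv f" "dv g"] by simp
qed

lemma Ck_on_subset: "Ck_on n D f \<Longrightarrow> E \<subseteq> D \<Longrightarrow> Ck_on n E f"
proof (induction n arbitrary: f)
  case 0
  then show ?case using continuous_on_subset by auto
next
  case (Suc n)
  then show ?case using differentiable_on_subset by auto
qed

text \<open>Total differentiability is recorded along with the two partial derivatives because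
  \<open>Ck_on\<close> asks for both at each order.\<close>

lemma separated_derivatives:
  fixes \<alpha> \<beta> :: "3 \<Rightarrow> real \<Rightarrow> real"
  assumes \<alpha>: "\<And>i. (\<alpha> i has_real_derivative \<alpha>' i) (at (fst q))"
    and \<beta>: "\<And>i. (\<beta> i has_real_derivative \<beta>' i) (at (snd q))"
  defines "\<psi> \<equiv> \<lambda>q. \<chi> i. \<alpha> i (fst q) * \<beta> i (snd q)"
  shows "\<psi> differentiable (at q)"
    "du \<psi> q = (\<chi> i. \<alpha>' i * \<beta> i (snd q))"
    "dv \<psi> q = (\<chi> i. \<alpha> i (fst q) * \<beta>' i)"
proof -
  have "((\<lambda>q. \<alpha> i (fst q)) has_derivative (\<lambda>h. \<alpha>' i * fst h)) (at q)"
    "((\<lambda>q. \<beta> i (snd q)) has_derivative (\<lambda>h. \<beta>' i * snd h)) (at q)" for i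
    using has_derivative_compose[OF has_derivative_fst[OF has_derivative_ident] \<alpha>[of i, unfolded has_field_derivative_def]]
      has_derivative_compose[OF has_derivative_snd[OF has_derivative_ident] \<beta>[of i, unfolded has_field_derivative_def]]
    by simp_all
  then have "(\<psi> has_derivative (\<lambda>h. \<chi> i. \<alpha> i (fst q) * (\<beta>' i * snd h) + \<alpha>' i * fst h * \<beta> i (snd q))) (at q)"
    unfolding \<psi>_def by (intro has_derivative_vec_lambda has_derivative_mult)
  then show "\<psi> differentiable (at q)" by (rule differentiableI)
  have "((\<lambda>t. \<chi> i. \<alpha> i t * \<beta> i (snd q)) has_vector_derivative (\<chi> i. \<alpha>' i * \<beta> i (snd q))) (at (fst q))"
    unfolding has_vector_derivative_def
    by (rule has_derivative_eq_rhs[OF has_derivative_vec_lambda])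
      (rule \<alpha>[THEN DERIV_cmult_right, unfolded has_field_derivative_def], simp add: vec_eq_iff fun_eq_iff)
  then show "du \<psi> q = (\<chi> i. \<alpha>' i * \<beta> i (snd q))"
    by (simp add: du_def \<psi>_def vector_derivative_at)
  have "((\<lambda>t. \<chi> i. \<alpha> i (fst q) * \<beta> i t) has_vector_derivative (\<chi> i. \<alpha> i (fst q) * \<beta>' i)) (at (snd q))"
    unfolding has_vector_derivative_def
    by (rule has_derivative_eq_rhs[OF has_derivative_vec_lambda])
      (rule \<beta>[THEN DERIV_cmult, unfolded has_field_derivative_def], simp add: vec_eq_iff fun_eq_iff)
  then show "dv \<psi> q = (\<chi> i. \<alpha> i (fst q) * \<beta>' i)"
    by (simp add: dv_def \<psi>_def vector_derivative_at)
qed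

text \<open>Separated products are stable under \<open>du\<close> and \<open>dv\<close>: each merely
  differentiates one family of factors. The induction therefore has to range over all \<alpha> and
  \<beta>.\<close>

lemma Ck_on_separated:
  fixes \<alpha> \<beta> :: "3 \<Rightarrow> real \<Rightarrow> real"
  assumes "open S" "open T" "\<And>i. Cn_on n S (\<alpha> i)" "\<And>i. Cn_on n T (\<beta> i)"
  shows "Ck_on n (S \<times> T) (\<lambda>q. \<chi> i. \<alpha> i (fst q) * \<beta> i (snd q))"
  using assms(3,4)
proof (induction n arbitrary: \<alpha> \<beta>)
  case 0
  have \<alpha>: "continuous_on S (\<alpha> i)" and \<beta>: "continuous_on T (\<beta> i)" for i using 0 by simp_all
  have "continuous_on (S \<times> T) (\<lambda>q. \<alpha> i (fst q))" "continuous_on (S \<times> T) (\<lambda>q. \<beta> i (snd q))" for i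
    by (rule continuous_on_compose2[OF \<alpha> continuous_on_fst[OF continuous_on_id]]
        continuous_on_compose2[OF \<beta> continuous_on_snd[OF continuous_on_id]]; auto)+
  then have "continuous_on (S \<times> T) (\<lambda>q. \<alpha> i (fst q) * \<beta> i (snd q))" for i
    by (rule continuous_on_mult)
  then show ?case by (simp add: continuous_on_vec_lambda)
next
  case (Suc n)
  have "\<forall>i. \<exists>f'. (\<forall>x\<in>S. (\<alpha> i has_real_derivative f' x) (at x)) \<and> Cn_on n S f'"
    using Suc.prems(1) by simp
  from choice[OF this] obtain \<alpha>' where
    "\<forall>i. (\<forall>x\<in>S. (\<alpha> i has_real_derivative \<alpha>' i x) (at x)) \<and> Cn_on n S (\<alpha>' i)" ..
  then have \<alpha>': "x \<in> S \<Longrightarrow> (\<alpha> i has_real_derivative \<alpha>' i x) (at x)" "Cn_on n S (\<alpha>' i)" for i x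
    by simp_all
  have "\<forall>i. \<exists>f'. (\<forall>x\<in>T. (\<beta> i has_real_derivative f' x) (at x)) \<and> Cn_on n T f'"
    using Suc.prems(2) by simp
  from choice[OF this] obtain \<beta>' where
    "\<forall>i. (\<forall>x\<in>T. (\<beta> i has_real_derivative \<beta>' i x) (at x)) \<and> Cn_on n T (\<beta>' i)" ..
  then have \<beta>': "x \<in> T \<Longrightarrow> (\<beta> i has_real_derivative \<beta>' i x) (at x)" "Cn_on n T (\<beta>' i)" for i x
    by simp_all
  let ?\<psi> = "\<lambda>q. (\<chi> i. \<alpha> i (fst q) * \<beta> i (snd q)) :: real^3"
  have sep: "?\<psi> differentiable (at q)"
    "du ?\<psi> q = (\<chi> i. \<alpha>' i (fst q) * \<beta> i (snd q))"
    "dv ?\<psi> q = (\<chi> i. \<alpha> i (fst q) * \<beta>' i (snd q))" if "q \<in> S \<times> T" for q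
    using separated_derivatives[of \<alpha> "\<lambda>i. \<alpha>' i (fst q)" q \<beta> "\<lambda>i. \<beta>' i (snd q)"] \<alpha>'(1) \<beta>'(1) that
    by auto
  have "Ck_on n (S \<times> T) (du ?\<psi>)" "Ck_on n (S \<times> T) (dv ?\<psi>)"
    using Suc.IH[of \<alpha>' \<beta>] Suc.IH[of \<alpha> \<beta>'] \<alpha>'(2) \<beta>'(2) Suc.prems[THEN Cn_on_SucD] sep(2,3)
      Ck_on_cong[OF open_Times[OF assms(1,2)], of "\<lambda>q. \<chi> i. \<alpha>' i (fst q) * \<beta> i (snd q)" "du ?\<psi>" n]
      Ck_on_cong[OF open_Times[OF assms(1,2)], of "\<lambda>q. \<chi> i. \<alpha> i (fst q) * \<beta>' i (snd q)" "dv ?\<psi>" n]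
    by simp_all
  with sep(1) show ?case
    by (simp add: differentiable_at_imp_differentiable_on)
qed

text \<open>An instance of the local injectivity theorem for maps whose derivative varies
  continuously and is injective at the point; a nonzero cross product of the partial derivatives
  gives this injectivity. It supplies the condition \<open>inj_on\<close> of a principal
  chart.\<close>

lemma immersion_locally_injective:
  fixes \<psi> :: "real \<times> real \<Rightarrow> real^3"
  assumes D: "open D" "q \<in> D" and C1: "Ck_on 1 D \<psi>"
    and cross: "cross3 (du \<psi> q) (dv \<psi> q) \<noteq> 0"
  obtains r where "r > 0" "ball q r \<subseteq> D" "inj_on \<psi> (ball q r)"
proof -
  define L where "L x h = fst h *\<^sub>R du \<psi> x + snd h *\<^sub>R dv \<psi> x" for x h :: "real \<times> real"
  have diff: "\<psi> differentiable_on D" and cont: "continuous_on D (du \<psi>)" "continuous_on D (dv \<psi>)"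
    using C1 by auto
  have deriv: "(\<psi> has_derivative L x) (at x)" if x: "x \<in> D" for x
  proof -
    \<comment> \<open>The total derivative exists; restricting it to the two coordinate lines forces
      its values there to be the partial derivatives, which identifies it with
      \<open>L x\<close>.\<close>
    obtain L' where L': "(\<psi> has_derivative L') (at x)"
      using diff D(1) x differentiable_on_eq_differentiable_at differentiable_def by blast
    interpret L': bounded_linear L' using has_derivative_bounded_linear[OF L'] .
    have pair: "((\<lambda>t. (t, snd x)) has_derivative (\<lambda>h. (h, 0))) (at (fst x))"
      "((\<lambda>t. (fst x, t)) has_derivative (\<lambda>h. (0, h))) (at (snd x))"
      by (rule has_derivative_Pair[OF has_derivative_ident has_derivative_const]
          has_derivative_Pair[OF has_derivative_const has_derivative_ident])+
    have "((\<lambda>t. \<psi> (t, snd x)) has_derivative (\<lambda>h. L' (h, 0))) (at (fst x))"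
      using has_derivative_compose[OF pair(1), of \<psi> L'] L' by simp
    moreover have "((\<lambda>t. \<psi> (t, snd x)) has_derivative (\<lambda>h. h *\<^sub>R du \<psi> x)) (at (fst x))"
      using slice_fst_has_vector_derivative[OF diff D(1), of "fst x" "snd x"] x
      by (simp add: has_vector_derivative_def)
    ultimately have u: "L' (h, 0) = h *\<^sub>R du \<psi> x" for h
      using has_derivative_unique by metis
    have "((\<lambda>t. \<psi> (fst x, t)) has_derivative (\<lambda>h. L' (0, h))) (at (snd x))"
      using has_derivative_compose[OF pair(2), of \<psi> L'] L' by simp
    moreover have "((\<lambda>t. \<psi> (fst x, t)) has_derivative (\<lambda>h. h *\<^sub>R dv \<psi> x)) (at (snd x))"
      using slice_snd_has_vector_derivative[OF diff D(1), of "fst x" "snd x"] x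
      by (simp add: has_vector_derivative_def)
    ultimately have v: "L' (0, h) = h *\<^sub>R dv \<psi> x" for h
      using has_derivative_unique by metis
    have "L' h = L x h" for h
      using L'.add[of "(fst h, 0)" "(0, snd h)"] u v by (simp add: L_def)
    then show ?thesis using L' by (metis ext)
  qed
  have "linear (L q)"
    by (rule linearI) (simp_all add: L_def scaleR_add_left scaleR_add_right)
  moreover have "inj (L q)"
  proof (rule linear_injective_0[THEN iffD2, OF \<open>linear (L q)\<close>, rule_format])
    fix h assume "L q h = 0"
    \<comment> \<open>A cross product with one partial derivative removes its own coefficient and
      leaves the other coefficient times a nonzero vector.\<close>
    then have "cross3 (L q h) (dv \<psi> q) = 0" "cross3 (du \<psi> q) (L q h) = 0" by simp_all
    then have "fst h = 0" "snd h = 0"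
      using cross by (simp_all add: L_def cross_add_left cross_add_right cross_mult_left cross_mult_right)
    then show "h = 0" by (simp add: prod_eq_iff)
  qed
  ultimately obtain g where g: "linear g" "g \<circ> L q = id"
    using linear_injective_left_inverse by blast
  \<comment> \<open>Continuity of \<open>L\<close> at \<open>q\<close> in operator norm; the
    variation of the two partial derivatives, collected in \<open>N\<close>, dominates it.\<close>
  have "\<exists>d>0. \<forall>x. dist q x < d \<longrightarrow> onorm (\<lambda>h. L x h - L q h) < e" if "e > 0" for e
  proof -
    define N where "N x = norm (du \<psi> x - du \<psi> q) + norm (dv \<psi> x - dv \<psi> q)" for x
    have "isCont (du \<psi>) q" "isCont (dv \<psi>) q"
      using cont D continuous_on_eq_continuous_at by blast+
    then have "isCont N q" unfolding N_def by (intro continuous_intros)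
    then obtain d where d: "d > 0" "\<And>x. dist x q < d \<Longrightarrow> dist (N x) (N q) < e"
      using \<open>e > 0\<close> unfolding continuous_at_eps_delta by blast
    have "onorm (\<lambda>h. L x h - L q h) \<le> N x" for x
    proof (rule onorm_le)
      fix h :: "real \<times> real"
      have "L x h - L q h = fst h *\<^sub>R (du \<psi> x - du \<psi> q) + snd h *\<^sub>R (dv \<psi> x - dv \<psi> q)"
        by (simp add: L_def algebra_simps)
      also have "norm \<dots> \<le> \<bar>fst h\<bar> * norm (du \<psi> x - du \<psi> q) + \<bar>snd h\<bar> * norm (dv \<psi> x - dv \<psi> q)"
        by (rule norm_triangle_le) simp
      also have "\<dots> \<le> norm h * norm (du \<psi> x - du \<psi> q) + norm h * norm (dv \<psi> x - dv \<psi> q)"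
        using norm_fst_le[of "fst h" "snd h"] norm_snd_le[of "snd h" "fst h"]
        by (intro add_mono mult_right_mono) auto
      finally show "norm (L x h - L q h) \<le> N x * norm h" by (simp add: N_def algebra_simps)
    qed
    moreover have "N x < e" if "dist q x < d" for x
      using d(2)[of x] that by (simp add: dist_commute N_def)
    ultimately show ?thesis using d(1) by (meson le_less_trans)
  qed
  with has_derivative_locally_injective[of q D g L \<psi>] that D g deriv show ?thesis
    by (auto simp: linear_conv_bounded_linear)
qed

subsection \<open>Confocal coordinates\<close>

locale central_quadric =
  fixes a b c :: real
  assumes kind: "is_ellipsoid a b c \<or> is_one_sheet a b c \<or> is_two_sheets a b c"
begin

abbreviation Q :: "(real^3) set" where "Q \<equiv> quadric a b c"

definition ax :: "real^3" where "ax = vector [a, b, c]"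

text \<open>Component i is the derivative of (t - a)(t - b)(t - c) at the i-th axis, divided by that
  axis. These are the factors that occur in \<open>charpoly\<close>.\<close>

definition M :: "real^3" where
  "M = vector [(a - b) * (a - c) / a, (b - a) * (b - c) / b, (c - a) * (c - b) / c]"

definition grad :: "real^3 \<Rightarrow> real^3" where "grad p = (\<chi> i. p$i / ax$i)"

definition rsum :: "real^3 \<Rightarrow> real" where "rsum p = a + b + c - p \<bullet> p"

definition rprod :: "real^3 \<Rightarrow> real" where "rprod p = a * b * c * (grad p \<bullet> grad p)"

definition disc :: "real^3 \<Rightarrow> real" where "disc p = (rsum p)\<^sup>2 - 4 * rprod p"

text \<open>\<open>croot 1\<close> and \<open>croot (- 1)\<close> are the confocal coordinates \<open>u\<close> and \<open>v\<close>
  as functions on the quadric.\<close>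

definition croot :: "real \<Rightarrow> real^3 \<Rightarrow> real" where
  "croot e p = (rsum p + e * sqrt (disc p)) / 2"

text \<open>By \<open>root_prod\<close>, abc/(uv) is the inverse square of
  \<open>norm (grad p)\<close>, so this is the prescribed curvature written without chart
  parameters. It makes sense on the coordinate planes too and so provides the continuous
  extension.\<close>

definition curv :: "real \<Rightarrow> real^3 \<Rightarrow> real" where
  "curv e p = 1 / (croot e p * norm (grad p))"

lemma ax_simps [simp]: "ax$1 = a" "ax$2 = b" "ax$3 = c"
  by (simp_all add: ax_def)

lemma M_simps: "M$1 = (a - b) * (a - c) / a" "M$2 = (b - a) * (b - c) / b" "M$3 = (c - a) * (c - b) / c"
  by (simp_all add: M_def)

lemma distinct: "a \<noteq> 0" "b \<noteq> 0" "c \<noteq> 0" "a \<noteq> b" "a \<noteq> c" "b \<noteq> c" "b < a" "c < b"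
  using kind by (auto simp: is_ellipsoid_def is_one_sheet_def is_two_sheets_def)

lemma ax_nz: "ax$i \<noteq> 0"
  using distinct exhaust_3[of i] by auto

lemma M_nz: "M$i \<noteq> 0"
  using distinct exhaust_3[of i] by (auto simp: M_simps)

lemma ax_inj: "ax$i = ax$j \<Longrightarrow> i = j"
  using distinct exhaust_3[of i] exhaust_3[of j] by auto

lemma grad_nth [simp]: "grad p $ i = p$i / ax$i"
  by (simp add: grad_def)

lemma unit_normal_eq: "unit_normal a b c p = - sgn (grad p)"
proof -
  have "vector [p$1 / a, p$2 / b, p$3 / c] = grad p"
    by (simp add: vec_eq_iff forall_3)
  then show ?thesis by (simp add: unit_normal_def)
qed

lemma Q_iff: "p \<in> Q \<longleftrightarrow> p \<bullet> grad p = 1"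
  by (simp add: quadric_def inner_vec_def sum_3 power2_eq_square)

lemma grad_nz: "p \<in> Q \<Longrightarrow> grad p \<noteq> 0"
  by (auto simp: Q_iff)

text \<open>Both sides are affine in X = x^2/a, Y = y^2/b and Z = z^2/c. The equation of the quadric
  eliminates X, and a polynomial identity in Y and Z remains.\<close>

lemma charpoly:
  assumes "p \<in> Q"
  shows "(ax$i)\<^sup>2 - rsum p * ax$i + rprod p = M$i * (p$i)\<^sup>2"
proof -
  have q: "(p$1)\<^sup>2 / a + (p$2)\<^sup>2 / b + (p$3)\<^sup>2 / c = 1"
    using assms by (simp add: quadric_def)
  define X Y Z where "X = (p$1)\<^sup>2 / a" and "Y = (p$2)\<^sup>2 / b" and "Z = (p$3)\<^sup>2 / c"
  have xyz: "(p$1)\<^sup>2 = a * X" "(p$2)\<^sup>2 = b * Y" "(p$3)\<^sup>2 = c * Z" "X = 1 - Y - Z"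
    using distinct q by (auto simp: X_def Y_def Z_def)
  have s: "rsum p = a + b + c - (a * X + b * Y + c * Z)"
    by (simp add: rsum_def inner_vec_def sum_3 flip: power2_eq_square xyz)
  have r: "rprod p = a * b * c * (X / a + Y / b + Z / c)"
    using distinct by (simp add: rprod_def inner_vec_def sum_3 X_def Y_def Z_def power2_eq_square)
  have r': "rprod p = b * c * X + a * c * Y + a * b * Z"
    unfolding r using distinct by (simp add: field_simps)
  consider "i = 1" | "i = 2" | "i = 3" using exhaust_3 by blast
  then show ?thesis
    by cases (use distinct in \<open>simp_all add: s r' M_simps xyz(1-3)\<close>,
      simp_all add: xyz(4) algebra_simps power2_eq_square)
qed

lemma M_sgn:
  "is_ellipsoid a b c \<Longrightarrow> M$1 > 0 \<and> M$2 < 0 \<and> M$3 > 0"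
  "is_one_sheet a b c \<Longrightarrow> M$1 > 0 \<and> M$2 < 0 \<and> M$3 < 0"
  "is_two_sheets a b c \<Longrightarrow> M$1 > 0 \<and> M$2 > 0 \<and> M$3 < 0"
  unfolding M_simps
  by (intro conjI divide_pos_pos divide_neg_pos divide_pos_neg divide_neg_neg
        mult_pos_pos mult_neg_pos mult_pos_neg mult_neg_neg;
      force simp: is_ellipsoid_def is_one_sheet_def is_two_sheets_def)+

text \<open>A monic quadratic that takes a nonpositive value at a real point has real roots. The
  axes provide such a point, since \<open>M$2\<close> or \<open>M$3\<close> is negative for each
  kind of quadric.\<close>

lemma disc_nonneg:
  assumes "p \<in> Q"
  shows "disc p \<ge> 0"
proof -
  have "M$2 * (p$2)\<^sup>2 \<le> 0 \<or> M$3 * (p$3)\<^sup>2 \<le> 0"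
    using kind M_sgn by (meson less_imp_le mult_nonpos_nonneg zero_le_power2)
  then obtain i where "M$i * (p$i)\<^sup>2 \<le> 0" by blast
  moreover have "disc p = (2 * ax$i - rsum p)\<^sup>2 - 4 * ((ax$i)\<^sup>2 - rsum p * ax$i + rprod p)"
    by (simp add: disc_def power2_eq_square algebra_simps)
  ultimately show ?thesis
    using charpoly[OF assms, of i] by (smt (verit) zero_le_power2)
qed

lemma root_sum: "croot e p + croot (- e) p = rsum p"
  by (simp add: croot_def field_simps)

lemma root_diff: "croot e p - croot (- e) p = e * sqrt (disc p)"
  by (simp add: croot_def field_simps)

lemma root_prod:
  assumes "p \<in> Q" and "e\<^sup>2 = 1"
  shows "croot e p * croot (- e) p = rprod p"
proof -
  have "croot e p * croot (- e) p = ((rsum p)\<^sup>2 - e\<^sup>2 * (sqrt (disc p))\<^sup>2) / 4"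
    by (simp add: croot_def field_simps power2_eq_square)
  then show ?thesis
    using assms disc_nonneg[of p] by (simp add: disc_def)
qed

lemma rprod_nz: "p \<in> Q \<Longrightarrow> rprod p \<noteq> 0"
  using distinct grad_nz by (simp add: rprod_def)

lemma root_nz:
  assumes "p \<in> Q" and "e\<^sup>2 = 1"
  shows "croot e p \<noteq> 0"
  using root_prod[OF assms] rprod_nz[OF assms(1)] by auto

lemma root_axis:
  assumes "p \<in> Q" and "e\<^sup>2 = 1"
  shows "(croot e p - ax$i) * (croot (- e) p - ax$i) = M$i * (p$i)\<^sup>2"
  unfolding charpoly[OF assms(1), symmetric] root_prod[OF assms, symmetric] root_sum[of e, symmetric]
  by (simp add: algebra_simps power2_eq_square)

lemma root_unique:
  assumes "u + v = rsum p" "u * v = rprod p" "v \<le> u"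
  shows "croot 1 p = u" "croot (- 1) p = v"
proof -
  have "disc p = (u - v)\<^sup>2"
    unfolding disc_def assms(1,2)[symmetric] by (simp add: algebra_simps power2_eq_square)
  then have s: "sqrt (disc p) = u - v" using assms(3) by simp
  show "croot 1 p = u" "croot (- 1) p = v"
    unfolding croot_def s assms(1)[symmetric] by simp_all
qed

lemma root_le: "p \<in> Q \<Longrightarrow> croot (- 1) p \<le> croot 1 p"
  using root_diff[of 1 p] disc_nonneg[of p] real_sqrt_ge_zero[of "disc p"] by linarith

lemma root_eq_iff: "p \<in> Q \<Longrightarrow> e\<^sup>2 = 1 \<Longrightarrow> croot e p = croot (- e) p \<longleftrightarrow> disc p = 0"
  using root_diff[of e p] by auto

text \<open>By \<open>root_axis\<close>, an axis with negative \<open>M$i\<close> lies between the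
  two roots and one with positive \<open>M$i\<close> lies outside the open interval between them.
  The ranges follow from the sign patterns in \<open>M_sgn\<close>.\<close>

lemma root_range:
  assumes p: "p \<in> Q"
  shows "is_ellipsoid a b c \<Longrightarrow> croot 1 p \<in> {b..a} \<and> croot (- 1) p \<in> {c..b}"
    "is_one_sheet a b c \<Longrightarrow> croot 1 p \<in> {b..a} \<and> croot (- 1) p \<in> {..c}"
    "is_two_sheets a b c \<Longrightarrow> croot 1 p \<in> {c..b} \<and> croot (- 1) p \<in> {..c}"
proof -
  have between: "croot (- 1) p \<le> ax$i \<and> ax$i \<le> croot 1 p" if "M$i < 0" for i
  proof -
    have "(croot 1 p - ax$i) * (croot (- 1) p - ax$i) \<le> 0"
      using root_axis[OF p, of 1 i] that by (simp add: mult_nonpos_nonneg)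
    with root_le[OF p] show ?thesis by (auto simp: mult_le_0_iff)
  qed
  have outside: "ax$i \<le> croot (- 1) p \<or> croot 1 p \<le> ax$i" if "M$i > 0" for i
  proof -
    have "(croot 1 p - ax$i) * (croot (- 1) p - ax$i) \<ge> 0"
      using root_axis[OF p, of 1 i] that by simp
    with root_le[OF p] show ?thesis by (auto simp: zero_le_mult_iff)
  qed
  note between = between[of 1] between[of 2] between[of 3]
    and outside = outside[of 1] outside[of 2] outside[of 3]
  show "is_ellipsoid a b c \<Longrightarrow> croot 1 p \<in> {b..a} \<and> croot (- 1) p \<in> {c..b}"
    using between outside M_sgn(1) distinct by auto
  show "is_one_sheet a b c \<Longrightarrow> croot 1 p \<in> {b..a} \<and> croot (- 1) p \<in> {..c}"
    using between outside M_sgn(2) distinct by auto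
  show "is_two_sheets a b c \<Longrightarrow> croot 1 p \<in> {c..b} \<and> croot (- 1) p \<in> {..c}"
    using between outside M_sgn(3) distinct by auto
qed

text \<open>Converse of \<open>root_axis\<close>. Solving for the squared coordinates turns the
  three claims into divided differences of (t - u)(t - v), multiplied by 1, t and 1/t, at the nodes
  a, b, c; for instance the first is the leading coefficient 1.\<close>

lemma Q_from_roots:
  assumes "\<And>i. (ax$i - u) * (ax$i - v) = M$i * (p$i)\<^sup>2"
  shows "p \<in> Q" "u + v = rsum p" "u * v = rprod p"
proof -
  \<comment> \<open>A common denominator for the three squared coordinates; over it the claims
    become polynomial identities.\<close>
  define D where "D = (a - b) * (a - c) * (b - c)"
  have D: "D \<noteq> 0" using distinct by (simp add: D_def)
  define N1 N2 N3 where "N1 = (a - u) * (a - v)" and "N2 = (b - u) * (b - v)" and "N3 = (c - u) * (c - v)"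
  have "a * N1 = (a - b) * (a - c) * (p$1)\<^sup>2" "b * N2 = (b - a) * (b - c) * (p$2)\<^sup>2"
    "c * N3 = (c - a) * (c - b) * (p$3)\<^sup>2"
    using assms[of 1] assms[of 2] assms[of 3] distinct
    by (simp_all add: M_simps N1_def N2_def N3_def)
  then have "(p$1)\<^sup>2 * D = a * N1 * (b - c)" "(p$2)\<^sup>2 * D = - b * N2 * (a - c)"
    "(p$3)\<^sup>2 * D = c * N3 * (a - b)"
    unfolding D_def by algebra+
  then have sq: "(p$1)\<^sup>2 = a * N1 * (b - c) / D" "(p$2)\<^sup>2 = - b * N2 * (a - c) / D"
    "(p$3)\<^sup>2 = c * N3 * (a - b) / D"
    using nonzero_eq_divide_eq[OF D] by blast+
  have "(p$1)\<^sup>2 / a + (p$2)\<^sup>2 / b + (p$3)\<^sup>2 / c = (N1 * (b - c) - N2 * (a - c) + N3 * (a - b)) / D"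
    unfolding sq using distinct by (simp add: add_divide_distrib diff_divide_distrib)
  also have "N1 * (b - c) - N2 * (a - c) + N3 * (a - b) = D"
    unfolding N1_def N2_def N3_def D_def by algebra
  finally show "p \<in> Q" using D by (simp add: quadric_def)
  have "p \<bullet> p = (a * N1 * (b - c) - b * N2 * (a - c) + c * N3 * (a - b)) / D"
    using sq by (simp add: inner_vec_def sum_3 power2_eq_square add_divide_distrib diff_divide_distrib)
  also have "a * N1 * (b - c) - b * N2 * (a - c) + c * N3 * (a - b) = (a + b + c - u - v) * D"
    unfolding N1_def N2_def N3_def D_def by algebra
  finally show "u + v = rsum p" using D by (simp add: rsum_def)
  have "grad p \<bullet> grad p = (p$1)\<^sup>2 / a\<^sup>2 + (p$2)\<^sup>2 / b\<^sup>2 + (p$3)\<^sup>2 / c\<^sup>2"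
    by (simp add: inner_vec_def sum_3 power2_eq_square)
  also have "\<dots> = (N1 * (b - c) / a - N2 * (a - c) / b + N3 * (a - b) / c) / D"
    unfolding sq using distinct
    by (simp add: add_divide_distrib diff_divide_distrib power2_eq_square mult_ac)
  finally have "rprod p = a * b * c * (N1 * (b - c) / a - N2 * (a - c) / b + N3 * (a - b) / c) / D"
    by (simp add: rprod_def)
  also have "a * b * c * (N1 * (b - c) / a - N2 * (a - c) / b + N3 * (a - b) / c)
      = b * c * N1 * (b - c) - a * c * N2 * (a - c) + a * b * N3 * (a - b)"
    using distinct by (simp add: field_simps)
  also have "b * c * N1 * (b - c) - a * c * N2 * (a - c) + a * b * N3 * (a - b) = u * v * D"
    unfolding N1_def N2_def N3_def D_def by algebra
  finally show "u * v = rprod p" using D by simp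
qed

lemma curv_eq_coords:
  assumes "p \<in> Q" "e\<^sup>2 = 1"
  shows "curv e p = 1 / croot e p * sqrt (a * b * c / (croot 1 p * croot (- 1) p))"
proof -
  have "a * b * c / (croot 1 p * croot (- 1) p) = 1 / (norm (grad p))\<^sup>2"
    using root_prod[OF assms(1), of 1] distinct grad_nz[OF assms(1)]
    by (simp add: rprod_def power2_norm_eq_inner)
  then show ?thesis
    by (simp add: curv_def real_sqrt_divide)
qed

section \<open>The explicit charts and the continuous extension of the curvatures\<close>

lemma chart_eq:
  "confocal_chart a b c (s1, s2, s3) (u, v) =
     (\<chi> i. vector [s1, s2, s3] $ i * sqrt ((ax$i - u) * (ax$i - v) / M$i))"
proof -
  have "a * (u - a) * (v - a) / ((b - a) * (c - a)) = (a - u) * (a - v) / M$1"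
    "b * (u - b) * (v - b) / ((b - a) * (b - c)) = (b - u) * (b - v) / M$2"
    "c * (u - c) * (v - c) / ((c - a) * (c - b)) = (c - u) * (c - v) / M$3"
    using distinct unfolding M_simps by (simp_all add: divide_simps) (algebra+)?
  then show ?thesis
    by (simp add: confocal_chart_def vec_eq_iff forall_3)
qed

lemma dom_sign:
  assumes "(u, v) \<in> confocal_dom a b c"
  shows "(ax$i - u) * (ax$i - v) / M$i \<ge> 0" "v < u"
proof -
  have "(ax$i - u) * (ax$i - v) / M$i \<ge> 0 \<and> v < u"
    using assms kind M_sgn exhaust_3[of i]
    by (auto simp: confocal_dom_def is_ellipsoid_def is_one_sheet_def is_two_sheets_def
        zero_le_divide_iff zero_le_mult_iff mult_le_0_iff)
  then show "(ax$i - u) * (ax$i - v) / M$i \<ge> 0" "v < u" by auto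
qed

text \<open>The radicands are nonnegative on the domain, so squaring the components gives the
  hypothesis of \<open>Q_from_roots\<close>. Hence \<open>croot 1\<close> and
  \<open>croot (- 1)\<close> invert the chart for every choice of signs.\<close>

lemma chart_props:
  assumes "(u, v) \<in> confocal_dom a b c" "s \<in> {-1, 1} \<times> {-1, 1} \<times> {-1, 1}"
  shows "confocal_chart a b c s (u, v) \<in> Q"
    "croot 1 (confocal_chart a b c s (u, v)) = u"
    "croot (- 1) (confocal_chart a b c s (u, v)) = v"
proof -
  obtain s1 s2 s3 where s: "s = (s1, s2, s3)" by (cases s)
  define p where "p = confocal_chart a b c s (u, v)"
  have "(vector [s1, s2, s3] $ i)\<^sup>2 = (1 :: real)" for i :: 3
    using assms(2) exhaust_3[of i] by (auto simp: s)
  then have "(ax$i - u) * (ax$i - v) = M$i * (p$i)\<^sup>2" for i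
    using dom_sign(1)[OF assms(1), of i] M_nz[of i]
    by (simp add: p_def s chart_eq power_mult_distrib)
  note r = Q_from_roots[OF this]
  show "confocal_chart a b c s (u, v) \<in> Q" using r(1) by (simp add: p_def)
  show "croot 1 (confocal_chart a b c s (u, v)) = u"
    "croot (- 1) (confocal_chart a b c s (u, v)) = v"
    using root_unique[OF r(2,3)] dom_sign(2)[OF assms(1)] by (simp_all add: p_def)
qed

lemma root_in_closure:
  assumes "p \<in> Q"
  shows "(croot 1 p, croot (- 1) p) \<in> closure (confocal_dom a b c)"
  using kind
proof (elim disjE)
  assume "is_ellipsoid a b c"
  then show ?thesis using root_range(1)[OF assms] distinct
    by (simp add: confocal_dom_def closure_Times)
next
  assume "is_one_sheet a b c"
  then show ?thesis using root_range(2)[OF assms] distinct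
    by (simp add: confocal_dom_def closure_Times is_ellipsoid_def is_one_sheet_def)
next
  assume "is_two_sheets a b c"
  then show ?thesis using root_range(3)[OF assms] distinct
    by (simp add: confocal_dom_def closure_Times is_ellipsoid_def is_one_sheet_def is_two_sheets_def)
qed

text \<open>By \<open>root_axis\<close> the radicands at the roots of \<open>p\<close> are the
  squares of its coordinates; only the signs remain to be chosen. The roots may lie on the boundary
  of the domain, so with \<open>root_in_closure\<close> this yields density of the charts.\<close>

lemma chart_closure:
  assumes p: "p \<in> Q"
  obtains s where "s \<in> {-1, 1} \<times> {-1, 1} \<times> {-1, 1}"
    "confocal_chart a b c s (croot 1 p, croot (- 1) p) = p"
proof -
  define \<sigma> :: "real \<Rightarrow> real" where "\<sigma> x = (if x \<ge> 0 then 1 else - 1)" for x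
  have "\<sigma> (p$i) * sqrt ((ax$i - croot 1 p) * (ax$i - croot (- 1) p) / M$i) = p$i" for i
  proof -
    have "(ax$i - croot 1 p) * (ax$i - croot (- 1) p) / M$i = (p$i)\<^sup>2"
      using root_axis[OF p, of 1 i] M_nz[of i] by (simp add: field_simps)
    then show ?thesis by (simp add: \<sigma>_def)
  qed
  from this[of 1] this[of 2] this[of 3]
  have "confocal_chart a b c (\<sigma> (p$1), \<sigma> (p$2), \<sigma> (p$3)) (croot 1 p, croot (- 1) p) = p"
    unfolding chart_eq vec_eq_iff forall_3 by simp
  moreover have "(\<sigma> (p$1), \<sigma> (p$2), \<sigma> (p$3)) \<in> {-1, 1} \<times> {-1, 1} \<times> {-1, 1}"
    by (simp add: \<sigma>_def)
  ultimately show ?thesis using that by blast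
qed

lemma continuous_on_grad: "continuous_on S grad"
  unfolding grad_def by (intro continuous_intros) (use ax_nz in auto)

lemma continuous_on_croot: "continuous_on S (croot e)"
proof -
  have "continuous_on S rsum" "continuous_on S rprod"
    unfolding rsum_def rprod_def by (intro continuous_intros continuous_on_grad)+
  then show ?thesis
    unfolding croot_def disc_def by (intro continuous_intros) auto
qed

lemma continuous_on_curv:
  assumes "e\<^sup>2 = 1"
  shows "continuous_on Q (curv e)"
  unfolding curv_def
  by (intro continuous_intros continuous_on_grad continuous_on_croot)
    (use root_nz[OF _ assms] grad_nz in auto)

text \<open>Resolves the definite description: any candidate agrees with \<open>k\<close> on the
  charts, hence by density on the whole quadric, and the convention fixes it elsewhere.\<close>

lemma quadric_ext_unique:
  assumes k: "continuous_on Q k"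
    and eq: "\<And>s q. s \<in> {-1, 1} \<times> {-1, 1} \<times> {-1, 1} \<Longrightarrow> q \<in> confocal_dom a b c \<Longrightarrow>
      k (confocal_chart a b c s q) = \<kappa> q"
  shows "quadric_ext a b c \<kappa> = (\<lambda>p. if p \<in> Q then k p else 0)"
  unfolding quadric_ext_def
proof (rule the_equality)
  let ?k = "\<lambda>p. if p \<in> Q then k p else 0"
  have "continuous_on Q ?k"
    using k by (rule continuous_on_eq) simp
  then show "continuous_on Q ?k \<and> (\<forall>p. p \<notin> Q \<longrightarrow> ?k p = 0) \<and>
    (\<forall>s \<in> {-1, 1} \<times> {-1, 1} \<times> {-1, 1}. \<forall>q \<in> confocal_dom a b c. ?k (confocal_chart a b c s q) = \<kappa> q)"
    using eq chart_props(1) by (auto split: prod.splits)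
next
  fix k' assume k': "continuous_on Q k' \<and> (\<forall>p. p \<notin> Q \<longrightarrow> k' p = 0) \<and>
    (\<forall>s \<in> {-1, 1} \<times> {-1, 1} \<times> {-1, 1}. \<forall>q \<in> confocal_dom a b c. k' (confocal_chart a b c s q) = \<kappa> q)"
  show "k' = (\<lambda>p. if p \<in> Q then k p else 0)"
  proof
    fix p
    show "k' p = (if p \<in> Q then k p else 0)"
    proof (cases "p \<in> Q")
      case True
      obtain s where s: "s \<in> {-1, 1} \<times> {-1, 1} \<times> {-1, 1}"
        "confocal_chart a b c s (croot 1 p, croot (- 1) p) = p"
        using chart_closure[OF True] .
      obtain x where x: "\<And>n. x n \<in> confocal_dom a b c" "x \<longlonglongrightarrow> (croot 1 p, croot (- 1) p)"
        using root_in_closure[OF True] closure_sequential by blast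
      obtain s1 s2 s3 where s': "s = (s1, s2, s3)" by (cases s)
      \<comment> \<open>The chart formula is continuous on the whole plane, because
        \<open>sqrt\<close> is total and continuous on the reals; so the limit at a boundary point
        of the domain is its value there.\<close>
      have "continuous_on UNIV (\<lambda>q. confocal_chart a b c s (fst q, snd q))"
        unfolding s' chart_eq by (intro continuous_intros) (use M_nz in auto)
      then have cc: "continuous_on UNIV (confocal_chart a b c s)" by simp
      have lim: "(\<lambda>n. confocal_chart a b c s (x n)) \<longlonglongrightarrow> p"
        using continuous_on_tendsto_compose[OF cc x(2)] s(2) by simp
      have mem: "confocal_chart a b c s (x n) \<in> Q" for n
        using chart_props(1)[OF _ s(1)] x(1) by (metis surj_pair)
      have conv: "(\<lambda>n. \<kappa> (x n)) \<longlonglongrightarrow> f p"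
        if "continuous_on Q f" "\<And>n. f (confocal_chart a b c s (x n)) = \<kappa> (x n)" for f
        using continuous_on_tendsto_compose[OF that(1) lim True] mem that(2) by simp
      have "(\<lambda>n. \<kappa> (x n)) \<longlonglongrightarrow> k' p" "(\<lambda>n. \<kappa> (x n)) \<longlonglongrightarrow> k p"
        by (rule conv; use k k' eq s(1) x(1) in blast)+
      then show ?thesis using True LIMSEQ_unique by auto
    qed (use k' in auto)
  qed
qed

lemma curv1_eq: "p \<in> Q \<Longrightarrow> curv1 a b c p = curv 1 p"
  and curv2_eq: "p \<in> Q \<Longrightarrow> curv2 a b c p = curv (- 1) p"
proof -
  have *: "curv e (confocal_chart a b c s (u, v)) = 1 / croot e (confocal_chart a b c s (u, v)) * sqrt (a * b * c / (u * v))"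
    if "s \<in> {-1, 1} \<times> {-1, 1} \<times> {-1, 1}" "(u, v) \<in> confocal_dom a b c" "e\<^sup>2 = 1" for s u v e
    using curv_eq_coords[OF chart_props(1)[OF that(2,1)] that(3)] chart_props(2,3)[OF that(2,1)] by simp
  show "curv1 a b c p = curv 1 p" if "p \<in> Q"
    using quadric_ext_unique[OF continuous_on_curv[of 1], of "\<lambda>(u, v). 1 / u * sqrt (a * b * c / (u * v))"] that
      *[of _ _ _ 1] chart_props(2)
    by (auto simp: curv1_def)
  show "curv2 a b c p = curv (- 1) p" if "p \<in> Q"
    using quadric_ext_unique[OF continuous_on_curv[of "- 1"], of "\<lambda>(u, v). 1 / v * sqrt (a * b * c / (u * v))"] that
      *[of _ _ _ "- 1"] chart_props(3)
    by (auto simp: curv2_def)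
qed

lemma umbilics_iff: "p \<in> umbilics a b c \<longleftrightarrow> p \<in> Q \<and> disc p = 0"
proof -
  have "curv 1 p = curv (- 1) p \<longleftrightarrow> croot 1 p = croot (- 1) p" if "p \<in> Q"
    using root_nz[OF that, of 1] root_nz[OF that, of "- 1"] grad_nz[OF that]
    by (auto simp: curv_def divide_simps)
  then show ?thesis
    using root_eq_iff[of p 1] by (auto simp: umbilics_def curv1_eq curv2_eq)
qed

subsection \<open>Curves with principal velocity\<close>

lemma bounded_linear_grad: "bounded_linear grad"
proof -
  have "linear grad"
    by (rule linearI) (simp_all add: vec_eq_iff add_divide_distrib)
  then show ?thesis by (simp add: linear_conv_bounded_linear)
qed

lemma grad_sym: "x \<bullet> grad y = grad x \<bullet> y"
  by (simp add: inner_vec_def)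

text \<open>Multiply relation i by p_i / a_i and sum. Since (r - a_i) / a_i = r / a_i - 1, one side
  is r (p \<bullet> grad w) - p \<bullet> w, and the first term vanishes by tangency; the other side
  is \<tau>.\<close>

lemma principal_coefficient:
  assumes "\<And>i. w$i * (r - ax$i) = \<tau> * p$i" "p \<bullet> grad w = 0" "p \<in> Q"
  shows "\<tau> = - (p \<bullet> w)"
proof -
  have "\<tau> * (p \<bullet> grad p) = (\<Sum>i\<in>UNIV. \<tau> * p$i * (p$i / ax$i))"
    by (simp add: inner_vec_def sum_distrib_left mult.assoc)
  also have "\<dots> = (\<Sum>i\<in>UNIV. r * (p$i * (w$i / ax$i)) - p$i * w$i)"
    by (rule sum.cong[OF refl], unfold assms(1)[symmetric]) (use ax_nz in \<open>simp add: field_simps\<close>)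
  also have "\<dots> = r * (p \<bullet> grad w) - p \<bullet> w"
    by (simp add: inner_vec_def sum_subtractf sum_distrib_left)
  finally show ?thesis using assms(2,3) by (simp add: Q_iff)
qed

lemma grad_has_vector_derivative:
  assumes "(\<gamma> has_vector_derivative w) (at t)"
  shows "((\<lambda>s. grad (\<gamma> s)) has_vector_derivative grad w) (at t)"
  by (rule bounded_linear.has_vector_derivative[OF bounded_linear_grad assms])

lemma curve_tangent:
  assumes d: "(\<gamma> has_vector_derivative w) (at t)"
    and q: "eventually (\<lambda>s. \<gamma> s \<in> Q) (nhds t)"
  shows "\<gamma> t \<bullet> grad w = 0"
proof -
  have "((\<lambda>s. \<gamma> s \<bullet> grad (\<gamma> s)) has_real_derivative \<gamma> t \<bullet> grad w + w \<bullet> grad (\<gamma> t)) (at t)"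
    by (rule inner_has_real_derivative[OF d grad_has_vector_derivative[OF d]])
  moreover have "eventually (\<lambda>s. \<gamma> s \<bullet> grad (\<gamma> s) = 1) (nhds t)"
    using q by (simp add: Q_iff)
  ultimately have "((\<lambda>s. 1) has_real_derivative \<gamma> t \<bullet> grad w + w \<bullet> grad (\<gamma> t)) (at t)"
    using DERIV_cong_ev[OF refl _ refl, of "\<lambda>s. \<gamma> s \<bullet> grad (\<gamma> s)" "\<lambda>s. 1"] by simp
  then have "\<gamma> t \<bullet> grad w + w \<bullet> grad (\<gamma> t) = 0"
    by (rule DERIV_unique[OF _ DERIV_const])
  then show ?thesis using grad_sym[of w "\<gamma> t"] inner_commute[of "grad w" "\<gamma> t"] by simp
qed

lemma norm_grad_has_real_derivative:
  assumes d: "(\<gamma> has_vector_derivative w) (at t)" and nz: "grad (\<gamma> t) \<noteq> 0"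
  shows "((\<lambda>s. norm (grad (\<gamma> s))) has_real_derivative
    (grad (\<gamma> t) \<bullet> grad w) / norm (grad (\<gamma> t))) (at t)"
proof -
  note dg = grad_has_vector_derivative[OF d]
  have "((\<lambda>s. sqrt (grad (\<gamma> s) \<bullet> grad (\<gamma> s))) has_real_derivative
      inverse (sqrt (grad (\<gamma> t) \<bullet> grad (\<gamma> t))) / 2 *
      (grad (\<gamma> t) \<bullet> grad w + grad w \<bullet> grad (\<gamma> t))) (at t)"
    by (rule DERIV_chain2[OF DERIV_real_sqrt inner_has_real_derivative[OF dg dg]]) (use nz in auto)
  then show ?thesis
    using inner_commute[of "grad w" "grad (\<gamma> t)"]
    by (simp add: inverse_eq_divide norm_eq_sqrt_inner)
qed

lemma unit_normal_has_vector_derivative: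
  assumes d: "(\<gamma> has_vector_derivative w) (at t)" and nz: "grad (\<gamma> t) \<noteq> 0"
  defines "n \<equiv> norm (grad (\<gamma> t))"
  shows "((unit_normal a b c \<circ> \<gamma>) has_vector_derivative
    - (inverse n *\<^sub>R (grad w - (grad (\<gamma> t) \<bullet> grad w / n\<^sup>2) *\<^sub>R grad (\<gamma> t)))) (at t)"
proof -
  define mu where "mu = grad (\<gamma> t) \<bullet> grad w / n\<^sup>2"
  have n: "n > 0" using nz by (simp add: n_def)
  have "((\<lambda>s. inverse (norm (grad (\<gamma> s)))) has_real_derivative - (mu / n)) (at t)"
    using n by (auto intro!: derivative_eq_intros norm_grad_has_real_derivative[OF d nz]
        simp: n_def[symmetric] mu_def field_simps power2_eq_square)
  from has_vector_derivative_scaleR[OF this grad_has_vector_derivative[OF d]]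
  have "((\<lambda>s. inverse (norm (grad (\<gamma> s))) *\<^sub>R grad (\<gamma> s)) has_vector_derivative
      inverse n *\<^sub>R (grad w - mu *\<^sub>R grad (\<gamma> t))) (at t)"
    by (simp add: n_def algebra_simps divide_inverse)
  then show ?thesis
    unfolding o_def unit_normal_eq sgn_div_norm mu_def by (rule has_vector_derivative_minus)
qed

text \<open>The relation on \<open>w\<close> says that \<open>grad w\<close> is w/U plus a multiple
  of \<open>grad p\<close>. Differentiating the unit normal removes the normal part and leaves w/U.
  This is the converse of the first claim of \<open>principal_curve\<close> and serves to construct
  charts.\<close>

lemma principal_direction:
  assumes d: "(\<gamma> has_vector_derivative w) (at t)"
    and q: "eventually (\<lambda>s. \<gamma> s \<in> Q) (nhds t)"
    and e: "e\<^sup>2 = 1"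
    and w: "\<And>i. w$i * (croot e (\<gamma> t) - ax$i) = \<tau> * \<gamma> t $ i"
  shows "- vector_derivative (unit_normal a b c \<circ> \<gamma>) (at t) = curv e (\<gamma> t) *\<^sub>R w"
proof -
  define p where "p = \<gamma> t"
  define U n where "U = croot e p" and "n = norm (grad p)"
  have pQ: "p \<in> Q" using eventually_nhds_x_imp_x[OF q] by (simp add: p_def)
  have gnz: "grad p \<noteq> 0" and n: "n \<noteq> 0" using grad_nz[OF pQ] by (simp_all add: n_def)
  have U: "U \<noteq> 0" using root_nz[OF pQ e] by (simp add: U_def)
  have gw: "grad w = (\<tau> / U) *\<^sub>R grad p + (1 / U) *\<^sub>R w"
  proof -
    have "w$i / ax$i = \<tau> / U * (p$i / ax$i) + 1 / U * w$i" for i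
      using w[of i] U ax_nz[of i] by (simp add: U_def[symmetric] p_def[symmetric] field_simps)
    then show ?thesis by (simp add: vec_eq_iff)
  qed
  have "grad p \<bullet> w = 0"
    using curve_tangent[OF d q] grad_sym[of p w] by (simp add: p_def)
  then have "grad p \<bullet> grad w / n\<^sup>2 = \<tau> / U"
    unfolding gw using n by (simp add: inner_add_right n_def power2_norm_eq_inner gnz)
  with unit_normal_has_vector_derivative[OF d] gnz
  have "((unit_normal a b c \<circ> \<gamma>) has_vector_derivative
      - (inverse n *\<^sub>R (grad w - (\<tau> / U) *\<^sub>R grad p))) (at t)"
    by (simp add: p_def n_def)
  then show ?thesis
    unfolding gw using n U
    by (simp add: vector_derivative_at curv_def p_def U_def n_def field_simps)
qed

text \<open>With U and V the values of \<open>croot e\<close> and \<open>croot (- e)\<close>, the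
  sum of the roots has derivative 2\<tau> and their product 2\<tau>V, so only U moves. Away from
  umbilic points the discriminant is positive, which makes its square root differentiable.\<close>

lemma principal_curve:
  assumes e: "e\<^sup>2 = 1"
    and d: "(\<gamma> has_vector_derivative w) (at t)"
    and q: "eventually (\<lambda>s. \<gamma> s \<in> Q) (nhds t)"
    and ev: "- vector_derivative (unit_normal a b c \<circ> \<gamma>) (at t) = curv e (\<gamma> t) *\<^sub>R w"
    and nz: "disc (\<gamma> t) \<noteq> 0"
  defines "\<tau> \<equiv> - (\<gamma> t \<bullet> w)"
  shows "w$i * (croot e (\<gamma> t) - ax$i) = \<tau> * \<gamma> t $ i"
    and "((\<lambda>s. croot e (\<gamma> s)) has_real_derivative 2 * \<tau>) (at t)"
    and "((\<lambda>s. croot (- e) (\<gamma> s)) has_real_derivative 0) (at t)"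
    and "((\<lambda>s. curv e (\<gamma> s)) has_real_derivative - 3 * \<tau> * curv e (\<gamma> t) / croot e (\<gamma> t)) (at t)"
proof -
  define p where "p = \<gamma> t"
  define U V n where "U = croot e p" and "V = croot (- e) p" and "n = norm (grad p)"
  have pQ: "p \<in> Q" using q eventually_nhds_x_imp_x unfolding p_def by fast
  have n: "n > 0" using grad_nz[OF pQ] by (simp add: n_def)
  have U: "U \<noteq> 0" using root_nz[OF pQ e] by (simp add: U_def)
  have n2: "grad p \<bullet> grad p = n\<^sup>2" by (simp add: n_def power2_norm_eq_inner)
  have UV: "U * V = a * b * c * n\<^sup>2"
    using root_prod[OF pQ e] by (simp add: U_def V_def rprod_def n2)
  have gnz: "grad (\<gamma> t) \<noteq> 0" using n by (auto simp: n_def p_def)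
  note dg = grad_has_vector_derivative[OF d]
  have tan: "p \<bullet> grad w = 0" using curve_tangent[OF d q] by (simp add: p_def)
  have dn: "((\<lambda>s. norm (grad (\<gamma> s))) has_real_derivative (grad p \<bullet> grad w) / n) (at t)"
    using norm_grad_has_real_derivative[OF d gnz] by (simp add: p_def n_def)
  define mu where "mu = (grad p \<bullet> grad w) / n\<^sup>2"
  have "((unit_normal a b c \<circ> \<gamma>) has_vector_derivative
      - (inverse n *\<^sub>R (grad w - mu *\<^sub>R grad p))) (at t)"
    using unit_normal_has_vector_derivative[OF d gnz] by (simp add: p_def n_def mu_def)
  from vector_derivative_at[OF this] ev
  have vec: "inverse n *\<^sub>R (grad w - mu *\<^sub>R grad p) = (1 / (U * n)) *\<^sub>R w"
    by (simp add: curv_def U_def n_def p_def)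
  have eig: "w$i * (U - ax$i) = mu * U * p$i" for i
  proof -
    have "(inverse n *\<^sub>R (grad w - mu *\<^sub>R grad p)) $ i = ((1 / (U * n)) *\<^sub>R w) $ i"
      by (simp only: vec)
    then have "w$i / ax$i - mu * p$i / ax$i = w$i / U"
      using n U by (simp add: field_simps)
    then show ?thesis using ax_nz[of i] U by (simp add: field_simps)
  qed
  have \<tau>: "\<tau> = mu * U"
    unfolding \<tau>_def p_def[symmetric] by (rule principal_coefficient[OF eig tan pQ, symmetric])
  show "w$i * (croot e (\<gamma> t) - ax$i) = \<tau> * \<gamma> t $ i"
    using eig[of i] unfolding \<tau> by (simp add: U_def p_def)
  have dS: "((\<lambda>s. rsum (\<gamma> s)) has_real_derivative 2 * \<tau>) (at t)"
    unfolding rsum_def \<tau>_def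
    by (auto intro!: derivative_eq_intros inner_has_real_derivative d simp: inner_commute)
  \<comment> \<open>The derivative is 2abc times \<open>grad p \<bullet> grad w\<close>, that is 2
    \<open>mu\<close> U V, and \<tau> = \<open>mu\<close> U.\<close>
  have dP: "((\<lambda>s. rprod (\<gamma> s)) has_real_derivative 2 * \<tau> * V) (at t)"
  proof -
    have "2 * \<tau> * V = a * b * c * (grad p \<bullet> grad w + grad w \<bullet> grad p)"
      using UV n unfolding \<tau> mu_def by (simp add: field_simps inner_commute)
    then show ?thesis unfolding rprod_def p_def
      by (auto intro!: derivative_eq_intros inner_has_real_derivative dg)
  qed
  have S: "rsum p = U + V" using root_sum[of e p] by (simp add: U_def V_def)
  define r where "r = sqrt (disc p)"
  have r: "r > 0" using disc_nonneg[OF pQ] nz by (simp add: r_def p_def)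
  have UmV: "U - V = e * r" using root_diff[of e p] by (simp add: U_def V_def r_def)
  have dD: "((\<lambda>s. disc (\<gamma> s)) has_real_derivative 4 * \<tau> * (e * r)) (at t)"
    unfolding disc_def UmV[symmetric]
    by (auto intro!: derivative_eq_intros dS dP simp: S p_def[symmetric] algebra_simps)
  have dr: "((\<lambda>s. sqrt (disc (\<gamma> s))) has_real_derivative 2 * \<tau> * e) (at t)"
    using DERIV_chain2[OF DERIV_real_sqrt dD] r
    by (simp add: r_def p_def field_simps)
  \<comment> \<open>One computation for both roots: as e^2 = 1, the choice e' = e gives 2\<tau> and
    e' = - e gives 0.\<close>
  have dU: "((\<lambda>s. croot e' (\<gamma> s)) has_real_derivative \<tau> + e' * e * \<tau>) (at t)" for e'
    unfolding croot_def
    using DERIV_cdivide[OF DERIV_add[OF dS DERIV_cmult[OF dr, of e']], of 2]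
    by (simp add: add_divide_distrib mult_ac)
  show "((\<lambda>s. croot e (\<gamma> s)) has_real_derivative 2 * \<tau>) (at t)"
    using dU[of e] e by (simp add: power2_eq_square)
  note dU' = this
  show "((\<lambda>s. croot (- e) (\<gamma> s)) has_real_derivative 0) (at t)"
    using dU[of "- e"] e by (simp add: power2_eq_square)
  have dn': "((\<lambda>s. norm (grad (\<gamma> s))) has_real_derivative mu * n) (at t)"
    using dn n by (simp add: mu_def power2_eq_square)
  \<comment> \<open>The logarithmic derivatives of U and of the norm are 2 \<open>mu\<close> and
    \<open>mu\<close>, so that of the curvature is - 3 \<open>mu\<close> = - 3\<tau>/U.\<close>
  show "((\<lambda>s. curv e (\<gamma> s)) has_real_derivative - 3 * \<tau> * curv e (\<gamma> t) / croot e (\<gamma> t)) (at t)"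
    unfolding curv_def p_def[symmetric] U_def[symmetric] n_def[symmetric]
    using n U
    by (auto intro!: derivative_eq_intros dU' dn'
        simp: p_def[symmetric] U_def[symmetric] n_def[symmetric] \<tau> field_simps)
qed

text \<open>Differentiate \<open>root_axis\<close> along the curve, where only
  \<open>croot e\<close> moves. Unlike the eigenvector relation, this still determines \<tau> near a
  point with \<open>croot e\<close> equal to \<open>ax$i\<close>, where the other root stays away
  from \<open>ax$i\<close>.\<close>

lemma principal_curve_axis:
  assumes e: "e\<^sup>2 = 1"
    and d: "(\<gamma> has_vector_derivative w) (at t)"
    and q: "eventually (\<lambda>s. \<gamma> s \<in> Q) (nhds t)"
    and ev: "- vector_derivative (unit_normal a b c \<circ> \<gamma>) (at t) = curv e (\<gamma> t) *\<^sub>R w"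
    and nz: "disc (\<gamma> t) \<noteq> 0"
  shows "- (\<gamma> t \<bullet> w) * (croot (- e) (\<gamma> t) - ax$i) = M$i * \<gamma> t $ i * w$i"
proof -
  note pc = principal_curve[OF assms]
  have "((\<lambda>s. (croot e (\<gamma> s) - ax$i) * (croot (- e) (\<gamma> s) - ax$i)) has_real_derivative
      2 * - (\<gamma> t \<bullet> w) * (croot (- e) (\<gamma> t) - ax$i)) (at t)"
    by (auto intro!: derivative_eq_intros pc(2,3))
  moreover have "eventually (\<lambda>s. (croot e (\<gamma> s) - ax$i) * (croot (- e) (\<gamma> s) - ax$i) = M$i * (\<gamma> s $ i)\<^sup>2) (nhds t)"
    using q by eventually_elim (rule root_axis[OF _ e])
  ultimately have l: "((\<lambda>s. M$i * (\<gamma> s $ i)\<^sup>2) has_real_derivative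
      2 * - (\<gamma> t \<bullet> w) * (croot (- e) (\<gamma> t) - ax$i)) (at t)"
    by (simp only: DERIV_cong_ev[OF refl _ refl])
  have "((\<lambda>s. \<gamma> s $ i) has_real_derivative w $ i) (at t)"
    using bounded_linear.has_vector_derivative[OF bounded_linear_vec_nth d]
    by (simp add: has_real_derivative_iff_has_vector_derivative)
  then have r: "((\<lambda>s. M$i * (\<gamma> s $ i)\<^sup>2) has_real_derivative 2 * M$i * \<gamma> t $ i * w$i) (at t)"
    by (auto intro!: derivative_eq_intros)
  show ?thesis using DERIV_unique[OF l r] by simp
qed

lemma isCont_disc: "isCont disc p"
proof -
  have "continuous_on UNIV disc"
    unfolding disc_def rsum_def rprod_def by (intro continuous_intros continuous_on_grad)
  then show ?thesis by (simp add: continuous_on_eq_continuous_at)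
qed

text \<open>The first derivative of the curvature vanishes exactly when \<tau> does. If \<tau> = 0,
  a nonzero component i of the velocity forces U = a_i; conversely U = a_i gives p_i = 0 by
  \<open>root_axis\<close>, and then \<tau> = 0 because V differs from a_i. Near such a point \<tau>
  is a continuous multiple of the i-th coordinate, which gives the second derivative.\<close>

lemma principal_curve_ridge:
  assumes e: "e\<^sup>2 = 1"
    and d: "eventually (\<lambda>s. (\<gamma> has_vector_derivative w s) (at s)) (nhds t)"
    and q: "eventually (\<lambda>s. \<gamma> s \<in> Q) (nhds t)"
    and ev: "eventually (\<lambda>s. - vector_derivative (unit_normal a b c \<circ> \<gamma>) (at s) = curv e (\<gamma> s) *\<^sub>R w s) (nhds t)"
    and nz: "disc (\<gamma> t) \<noteq> 0"
    and w: "w t \<noteq> 0" "isCont w t"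
  defines "\<kappa>' \<equiv> \<lambda>s. vector_derivative (\<lambda>r. curv e (\<gamma> r)) (at s)"
  shows "\<kappa>' t = 0 \<longleftrightarrow> (\<exists>i. croot e (\<gamma> t) = ax$i)"
    and "croot e (\<gamma> t) = ax$i \<Longrightarrow>
      \<exists>k>0. vector_derivative \<kappa>' (at t) / (curv e (\<gamma> t) - curv (- e) (\<gamma> t)) =
        - k * (M$i * ax$i * croot (- e) (\<gamma> t))"
proof -
  define p U V where "p = \<gamma> t" and "U = croot e p" and "V = croot (- e) p"
  have e': "(- e)\<^sup>2 = 1" using e by simp
  have pQ: "p \<in> Q" using eventually_nhds_x_imp_x[OF q] by (simp add: p_def)
  have dt: "(\<gamma> has_vector_derivative w t) (at t)" using eventually_nhds_x_imp_x[OF d] .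
  have "isCont \<gamma> t"
    using has_vector_derivative_continuous[OF dt] by simp
  then have "isCont (\<lambda>s. disc (\<gamma> s)) t"
    by (rule isCont_o2[OF _ isCont_disc])
  from isCont_eventually_neq[OF this nz]
  have nz': "eventually (\<lambda>s. disc (\<gamma> s) \<noteq> 0) (nhds t)" .
  \<comment> \<open>The hypotheses of \<open>principal_curve\<close> hold at all nearby parameters;
    \<open>\<kappa>'\<close> has to be known on a neighbourhood before it can be
    differentiated.\<close>
  have regular: "eventually (\<lambda>s. (\<gamma> has_vector_derivative w s) (at s) \<and>
      eventually (\<lambda>s. \<gamma> s \<in> Q) (nhds s) \<and>
      - vector_derivative (unit_normal a b c \<circ> \<gamma>) (at s) = curv e (\<gamma> s) *\<^sub>R w s \<and>
      disc (\<gamma> s) \<noteq> 0) (nhds t)"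
    using d ev nz' q[THEN eventually_eventually[THEN iffD2]] by eventually_elim simp
  have \<kappa>': "eventually (\<lambda>s. \<kappa>' s = - 3 * - (\<gamma> s \<bullet> w s) * curv e (\<gamma> s) / croot e (\<gamma> s)) (nhds t)"
    using regular
  proof eventually_elim
    case (elim s)
    from principal_curve(4)[OF e, of \<gamma> "w s" s] elim show ?case
      unfolding \<kappa>'_def has_real_derivative_iff_has_vector_derivative
      by (blast intro: vector_derivative_at)
  qed
  have axis: "eventually (\<lambda>s. - (\<gamma> s \<bullet> w s) * (croot (- e) (\<gamma> s) - ax$i) = M$i * \<gamma> s $ i * w s $ i) (nhds t)" for i
    using regular by eventually_elim (use principal_curve_axis[OF e] in blast)
  note pc = principal_curve[OF e dt q eventually_nhds_x_imp_x[OF ev] nz]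
  have UV: "U \<noteq> V" using root_eq_iff[OF pQ e] nz by (simp add: U_def V_def p_def)
  have U: "U \<noteq> 0" and V: "V \<noteq> 0"
    using root_nz[OF pQ e] root_nz[OF pQ e'] by (simp_all add: U_def V_def)
  have n: "norm (grad p) > 0" using grad_nz[OF pQ] by simp
  have K: "curv e p \<noteq> 0" using U n by (simp add: curv_def U_def)
  have zero_iff: "\<kappa>' t = 0 \<longleftrightarrow> p \<bullet> w t = 0"
    using eventually_nhds_x_imp_x[OF \<kappa>'] K U by (simp add: p_def U_def)
  have on_plane: "p $ i = 0" if "U = ax$i" for i
    using root_axis[OF pQ e, of i] M_nz[of i] that by (simp add: U_def)
  have zero: "p \<bullet> w t = 0" if "U = ax$i" for i
    using eventually_nhds_x_imp_x[OF axis, of i] on_plane[OF that] UV that by (simp add: p_def V_def)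
  show "\<kappa>' t = 0 \<longleftrightarrow> (\<exists>i. croot e (\<gamma> t) = ax$i)"
  proof
    assume "\<kappa>' t = 0"
    moreover obtain i where "w t $ i \<noteq> 0" using w(1) by (auto simp: vec_eq_iff)
    ultimately show "\<exists>i. croot e (\<gamma> t) = ax$i"
      using pc(1)[of i] zero_iff by (auto simp: p_def U_def)
  qed (use zero zero_iff in \<open>auto simp: p_def U_def\<close>)
  assume Ui: "croot e (\<gamma> t) = ax$i"
  then have Ui: "U = ax$i" by (simp add: U_def p_def)
  \<comment> \<open>With \<tau> = 0 the eigenvector relation kills every component whose axis
    differs from U, so component i is the only one left to carry the velocity.\<close>
  have wi: "w t $ i \<noteq> 0"
  proof
    assume "w t $ i = 0"
    moreover have "w t $ j = 0" if "j \<noteq> i" for j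
      using pc(1)[of j] zero[OF Ui] that ax_inj[of i j] Ui by (auto simp: p_def U_def)
    ultimately have "w t = 0" by (metis vec_eq_iff zero_index)
    then show False using w(1) by simp
  qed
  \<comment> \<open>The factor that remains in \<open>\<kappa>'\<close> when \<tau> is replaced by
    its expression from \<open>principal_curve_axis\<close> and the coordinate is split off.\<close>
  define \<Phi> where "\<Phi> s = - 3 * M$i * w s $ i * curv e (\<gamma> s) / (croot e (\<gamma> s) * (croot (- e) (\<gamma> s) - ax$i))" for s
  have cont: "isCont (\<lambda>s. croot e (\<gamma> s)) t" "isCont (\<lambda>s. croot (- e) (\<gamma> s)) t" "isCont (\<lambda>s. curv e (\<gamma> s)) t"
    by (rule pc(2-4)[THEN DERIV_isCont])+
  have \<Phi>: "isCont \<Phi> t"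
    unfolding \<Phi>_def using UV U Ui w(2) cont
    by (intro continuous_intros) (auto simp: U_def V_def p_def)
  have "eventually (\<lambda>s. croot (- e) (\<gamma> s) \<noteq> ax$i) (nhds t)"
    by (rule isCont_eventually_neq[OF cont(2)]) (use UV Ui in \<open>simp add: V_def p_def\<close>)
  then have \<kappa>'_eq: "eventually (\<lambda>s. \<kappa>' s = \<Phi> s * \<gamma> s $ i) (nhds t)"
    using \<kappa>' axis[of i]
  proof eventually_elim
    case (elim s)
    then have "- (\<gamma> s \<bullet> w s) = M$i * \<gamma> s $ i * w s $ i / (croot (- e) (\<gamma> s) - ax$i)"
      by (simp add: field_simps)
    then show ?case unfolding elim(2) \<Phi>_def by (simp add: mult_ac)
  qed
  have "((\<lambda>s. \<gamma> s $ i) has_real_derivative w t $ i) (at t)"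
    using bounded_linear.has_vector_derivative[OF bounded_linear_vec_nth dt]
    by (simp add: has_real_derivative_iff_has_vector_derivative)
  \<comment> \<open>In Caratheodory's form of the derivative, continuity of \<open>\<Phi>\<close> is
    enough to differentiate the product at a zero of the coordinate; the velocity \<open>w\<close>
    is only known to be continuous.\<close>
  then obtain g where g: "\<And>s. \<gamma> s $ i - p $ i = g s * (s - t)" "isCont g t" "g t = w t $ i"
    unfolding CARAT_DERIV p_def by blast
  have "((\<lambda>s. \<Phi> s * \<gamma> s $ i) has_real_derivative \<Phi> t * w t $ i) (at t)"
    unfolding CARAT_DERIV
    using g \<Phi> on_plane[OF Ui]
    by (intro exI[of _ "\<lambda>s. \<Phi> s * g s"]) (auto simp: p_def intro!: continuous_intros)
  then have "(\<kappa>' has_real_derivative \<Phi> t * w t $ i) (at t)"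
    using DERIV_cong_ev[OF refl \<kappa>'_eq refl] by blast
  then have "vector_derivative \<kappa>' (at t) = \<Phi> t * w t $ i"
    by (intro vector_derivative_at) (simp add: has_real_derivative_iff_has_vector_derivative)
  moreover have "\<Phi> t = - 3 * M$i * w t $ i * (1 / (U * norm (grad p))) / (U * (V - U))"
    unfolding \<Phi>_def using Ui by (simp add: p_def U_def V_def curv_def)
  moreover have "curv e p - curv (- e) p = (V - U) / (U * V * norm (grad p))"
    using U V n by (simp add: curv_def U_def[symmetric] V_def[symmetric] field_simps)
  ultimately have "vector_derivative \<kappa>' (at t) / (curv e p - curv (- e) p) =
     (- 3 * M$i * w t $ i * (1 / (U * norm (grad p))) / (U * (V - U)) * w t $ i) /
     ((V - U) / (U * V * norm (grad p)))"
    by (simp only:)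
  also have "\<dots> = - 3 * M$i * (w t $ i)\<^sup>2 * V / (U * (V - U)\<^sup>2)"
    using U V n UV by (simp add: power2_eq_square mult_ac)
  \<comment> \<open>One factor U = a_i is moved into the numerator, so that the remaining
    denominator is a square.\<close>
  also have "\<dots> = - (3 * (w t $ i)\<^sup>2 / (U * (V - U))\<^sup>2) * (M$i * ax$i * V)"
    using U UV by (simp add: Ui[symmetric] power2_eq_square mult_ac)
  finally show "\<exists>k>0. vector_derivative \<kappa>' (at t) / (curv e (\<gamma> t) - curv (- e) (\<gamma> t)) =
        - k * (M$i * ax$i * croot (- e) (\<gamma> t))"
    using U UV wi by (intro exI[of _ "3 * (w t $ i)\<^sup>2 / (U * (V - U))\<^sup>2"]) (auto simp: p_def V_def)
qed

subsection \<open>Ridges in principal charts\<close>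

text \<open>\<open>principal_curve_ridge\<close> with sign 1, applied to the coordinate line through
  \<open>q\<close> along which the second parameter is constant. Neither conclusion depends on the
  chart, apart from the positive factor.\<close>

lemma ridge1_in_chart:
  assumes "principal_chart_at a b c p \<psi> q" "p \<notin> umbilics a b c"
  shows "du (curv1 a b c \<circ> \<psi>) q = 0 \<longleftrightarrow> (\<exists>i. croot 1 p = ax$i)"
    and "croot 1 p = ax$i \<Longrightarrow> \<exists>k>0. sigma1 a b c \<psi> q = - k * (M$i * ax$i * croot (- 1) p)"
proof -
  obtain D where D: "principal_chart a b c D \<psi>" and q: "q \<in> D" and p: "\<psi> q = p"
    using assms(1) by (auto simp: principal_chart_at_def)
  have open_D: "open D" and diff: "\<psi> differentiable_on D" and cont: "continuous_on D (du \<psi>)"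
    and sub: "\<psi> ` D \<subseteq> Q"
    using D unfolding principal_chart_def smooth2_on_def by (auto dest!: spec[of _ "Suc 0"])
  define \<gamma> where "\<gamma> = (\<lambda>t. \<psi> (t, snd q))"
  define w where "w = (\<lambda>t. du \<psi> (t, snd q))"
  note ev_D = slice_fst_eventually[OF open_D q]
  have \<gamma>_q: "\<gamma> (fst q) = p" by (simp add: \<gamma>_def p)
  have pQ: "p \<in> Q" using sub q p by blast
  have 1: "eventually (\<lambda>s. (\<gamma> has_vector_derivative w s) (at s)) (nhds (fst q))"
    using ev_D by eventually_elim (simp add: \<gamma>_def w_def slice_fst_has_vector_derivative[OF diff open_D])
  have 2: "eventually (\<lambda>s. \<gamma> s \<in> Q) (nhds (fst q))"
    using ev_D by eventually_elim (use sub in \<open>auto simp: \<gamma>_def\<close>)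
  have 3: "eventually (\<lambda>s. - vector_derivative (unit_normal a b c \<circ> \<gamma>) (at s) = curv 1 (\<gamma> s) *\<^sub>R w s) (nhds (fst q))"
    using ev_D 2
  proof eventually_elim
    case (elim s)
    then have "- du (unit_normal a b c \<circ> \<psi>) (s, snd q) = curv1 a b c (\<gamma> s) *\<^sub>R w s"
      using D by (simp add: principal_chart_def \<gamma>_def w_def)
    with elim(2) show ?case by (simp add: du_def \<gamma>_def o_def curv1_eq)
  qed
  have 4: "disc (\<gamma> (fst q)) \<noteq> 0" using assms(2) pQ by (simp add: \<gamma>_q umbilics_iff)
  have 5: "w (fst q) \<noteq> 0"
    using D q by (auto simp: principal_chart_def w_def)
  have "isCont (du \<psi>) q" using cont open_D q continuous_on_eq_continuous_at by blast
  then have 6: "isCont w (fst q)"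
    unfolding w_def using isCont_o2[where f = "\<lambda>t. (t, snd q)" and a = "fst q" and g = "du \<psi>"]
    by (simp add: isCont_Pair)
  have eq: "eventually (\<lambda>s. curv1 a b c (\<psi> (s, snd q)) = curv 1 (\<gamma> s)) (nhds (fst q))"
    using 2 by eventually_elim (simp add: curv1_eq \<gamma>_def)
  \<comment> \<open>Agreement on a neighbourhood persists on neighbourhoods of nearby points, so the
    first derivatives agree near the point and the second derivatives agree at it.\<close>
  have eq': "eventually (\<lambda>s. du (curv1 a b c \<circ> \<psi>) (s, snd q) = vector_derivative (\<lambda>r. curv 1 (\<gamma> r)) (at s)) (nhds (fst q))"
    using eq[THEN eventually_eventually[THEN iffD2]]
  proof eventually_elim
    case (elim s)
    from vector_derivative_cong_nhds[OF elim] show ?case by (simp add: du_def o_def)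
  qed
  note rc = principal_curve_ridge[OF _ 1 2 3 4 5 6, unfolded \<gamma>_q]
  show "du (curv1 a b c \<circ> \<psi>) q = 0 \<longleftrightarrow> (\<exists>i. croot 1 p = ax$i)"
    using rc(1) eventually_nhds_x_imp_x[OF eq'] by simp
  have "du (du (curv1 a b c \<circ> \<psi>)) q =
      vector_derivative (\<lambda>s. vector_derivative (\<lambda>r. curv 1 (\<gamma> r)) (at s)) (at (fst q))"
    using vector_derivative_cong_nhds[OF eq'] unfolding du_def[of "du _"] .
  then show "croot 1 p = ax$i \<Longrightarrow> \<exists>k>0. sigma1 a b c \<psi> q = - k * (M$i * ax$i * croot (- 1) p)"
    using rc(2) pQ by (simp add: sigma1_def p curv1_eq curv2_eq)
qed

text \<open>The same argument with sign - 1, along the other coordinate line.\<close>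

lemma ridge2_in_chart:
  assumes "principal_chart_at a b c p \<psi> q" "p \<notin> umbilics a b c"
  shows "dv (curv2 a b c \<circ> \<psi>) q = 0 \<longleftrightarrow> (\<exists>i. croot (- 1) p = ax$i)"
    and "croot (- 1) p = ax$i \<Longrightarrow> \<exists>k>0. sigma2 a b c \<psi> q = - k * (M$i * ax$i * croot 1 p)"
proof -
  obtain D where D: "principal_chart a b c D \<psi>" and q: "q \<in> D" and p: "\<psi> q = p"
    using assms(1) by (auto simp: principal_chart_at_def)
  have open_D: "open D" and diff: "\<psi> differentiable_on D" and cont: "continuous_on D (dv \<psi>)"
    and sub: "\<psi> ` D \<subseteq> Q"
    using D unfolding principal_chart_def smooth2_on_def by (auto dest!: spec[of _ "Suc 0"])
  define \<gamma> where "\<gamma> = (\<lambda>t. \<psi> (fst q, t))"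
  define w where "w = (\<lambda>t. dv \<psi> (fst q, t))"
  note ev_D = slice_snd_eventually[OF open_D q]
  have \<gamma>_q: "\<gamma> (snd q) = p" by (simp add: \<gamma>_def p)
  have pQ: "p \<in> Q" using sub q p by blast
  have 1: "eventually (\<lambda>s. (\<gamma> has_vector_derivative w s) (at s)) (nhds (snd q))"
    using ev_D by eventually_elim (simp add: \<gamma>_def w_def slice_snd_has_vector_derivative[OF diff open_D])
  have 2: "eventually (\<lambda>s. \<gamma> s \<in> Q) (nhds (snd q))"
    using ev_D by eventually_elim (use sub in \<open>auto simp: \<gamma>_def\<close>)
  have 3: "eventually (\<lambda>s. - vector_derivative (unit_normal a b c \<circ> \<gamma>) (at s) = curv (- 1) (\<gamma> s) *\<^sub>R w s) (nhds (snd q))"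
    using ev_D 2
  proof eventually_elim
    case (elim s)
    then have "- dv (unit_normal a b c \<circ> \<psi>) (fst q, s) = curv2 a b c (\<gamma> s) *\<^sub>R w s"
      using D by (simp add: principal_chart_def \<gamma>_def w_def)
    with elim(2) show ?case by (simp add: dv_def \<gamma>_def o_def curv2_eq)
  qed
  have 4: "disc (\<gamma> (snd q)) \<noteq> 0" using assms(2) pQ by (simp add: \<gamma>_q umbilics_iff)
  have 5: "w (snd q) \<noteq> 0"
    using D q by (auto simp: principal_chart_def w_def)
  have "isCont (dv \<psi>) q" using cont open_D q continuous_on_eq_continuous_at by blast
  then have 6: "isCont w (snd q)"
    unfolding w_def using isCont_o2[where f = "\<lambda>t. (fst q, t)" and a = "snd q" and g = "dv \<psi>"]
    by (simp add: isCont_Pair)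
  have eq: "eventually (\<lambda>s. curv2 a b c (\<psi> (fst q, s)) = curv (- 1) (\<gamma> s)) (nhds (snd q))"
    using 2 by eventually_elim (simp add: curv2_eq \<gamma>_def)
  have eq': "eventually (\<lambda>s. dv (curv2 a b c \<circ> \<psi>) (fst q, s) = vector_derivative (\<lambda>r. curv (- 1) (\<gamma> r)) (at s)) (nhds (snd q))"
    using eq[THEN eventually_eventually[THEN iffD2]]
  proof eventually_elim
    case (elim s)
    from vector_derivative_cong_nhds[OF elim] show ?case by (simp add: dv_def o_def)
  qed
  note rc = principal_curve_ridge[OF _ 1 2 3 4 5 6, unfolded \<gamma>_q]
  show "dv (curv2 a b c \<circ> \<psi>) q = 0 \<longleftrightarrow> (\<exists>i. croot (- 1) p = ax$i)"
    using rc(1) eventually_nhds_x_imp_x[OF eq'] by simp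
  have "dv (dv (curv2 a b c \<circ> \<psi>)) q =
      vector_derivative (\<lambda>s. vector_derivative (\<lambda>r. curv (- 1) (\<gamma> r)) (at s)) (at (snd q))"
    using vector_derivative_cong_nhds[OF eq'] unfolding dv_def[of "dv _"] .
  then show "croot (- 1) p = ax$i \<Longrightarrow> \<exists>k>0. sigma2 a b c \<psi> q = - k * (M$i * ax$i * croot 1 p)"
    using rc(2) pQ by (simp add: sigma2_def p curv1_eq curv2_eq)
qed

subsection \<open>Existence of principal charts\<close>

text \<open>The chart folds along \<open>u = ax$i\<close>, so a regular parameter must be comparable to
  the square root of \<open>u - ax$i\<close> there; only at such points may \<open>u'\<close> vanish.\<close>

definition regular_param ::
  "real^3 \<Rightarrow> real set \<Rightarrow> (real \<Rightarrow> real) \<Rightarrow> (real \<Rightarrow> real) \<Rightarrow> (3 \<Rightarrow> real \<Rightarrow> real) \<Rightarrow> (3 \<Rightarrow> real \<Rightarrow> real) \<Rightarrow> bool" where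
  "regular_param \<kappa> S u u' \<alpha> \<alpha>' \<longleftrightarrow> open S \<and> (\<forall>i n. Cn_on n S (\<alpha> i)) \<and>
     (\<forall>s\<in>S. (u has_real_derivative u' s) (at s) \<and>
       (u' s \<noteq> 0 \<or> (\<exists>i. u s = ax$i \<and> \<alpha>' i s \<noteq> 0)) \<and>
       (\<forall>i. (\<alpha> i has_real_derivative \<alpha>' i s) (at s) \<and> (\<alpha> i s)\<^sup>2 = \<kappa>$i * (u s - ax$i)))"

lemma regular_param_deriv:
  assumes "regular_param \<kappa> S u u' \<alpha> \<alpha>'" "s \<in> S"
  shows "2 * \<alpha> i s * \<alpha>' i s = \<kappa>$i * u' s"
proof -
  have "((\<lambda>s. (\<alpha> i s)\<^sup>2) has_real_derivative 2 * \<alpha> i s * \<alpha>' i s) (at s)"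
    using assms by (auto simp: regular_param_def intro!: derivative_eq_intros)
  moreover have "((\<lambda>s. \<kappa>$i * (u s - ax$i)) has_real_derivative \<kappa>$i * u' s) (at s)"
    using assms by (auto simp: regular_param_def intro!: derivative_eq_intros)
  moreover have "eventually (\<lambda>s. (\<alpha> i s)\<^sup>2 = \<kappa>$i * (u s - ax$i)) (nhds s)"
    using assms eventually_nhds_in_open[of S s]
    by (auto simp: regular_param_def elim!: eventually_mono)
  ultimately show ?thesis
    using DERIV_unique by (simp add: DERIV_cong_ev[OF refl _ refl])
qed

text \<open>Multiplying by \<kappa>_i turns u - a_i into the square of \<alpha>_i, and
  \<open>regular_param_deriv\<close> applies. This is the relation required by
  \<open>principal_direction\<close>, up to the factor that depends on the other parameter.\<close>

lemma regular_param_eigen: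
  assumes "regular_param \<kappa> S u u' \<alpha> \<alpha>'" "s \<in> S" "\<kappa>$i \<noteq> 0"
  shows "\<alpha>' i s * (u s - ax$i) = u' s / 2 * \<alpha> i s"
proof -
  have "\<kappa>$i * (\<alpha>' i s * (u s - ax$i)) = \<alpha>' i s * (\<alpha> i s)\<^sup>2"
    using assms by (simp add: regular_param_def)
  also have "\<dots> = \<kappa>$i * (u' s / 2 * \<alpha> i s)"
    using regular_param_deriv[OF assms(1,2), of i] by (simp add: power2_eq_square algebra_simps)
  finally show ?thesis by (rule mult_left_cancel[OF assms(3), THEN iffD1])
qed

text \<open>Away from the axes u itself is a parameter. At u0 = a_i the substitution u = a_i +
  s^2/\<kappa>_i makes \<alpha>_i(s) = s, which crosses the coordinate plane smoothly; the other
  radicands stay positive nearby.\<close>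

lemma exists_regular_param:
  assumes \<kappa>: "\<And>i. \<kappa>$i \<noteq> 0" "\<And>i. u0 \<noteq> ax$i \<Longrightarrow> \<kappa>$i * (u0 - ax$i) > 0"
  obtains S u u' \<alpha> \<alpha>' s where "regular_param \<kappa> S u u' \<alpha> \<alpha>'" "s \<in> S" "u s = u0"
    "\<And>i. \<alpha> i s = sqrt (\<kappa>$i * (u0 - ax$i))"
proof (cases "\<exists>i. u0 = ax$i")
  case False
  define S where "S = (\<Inter>j. {s. \<kappa>$j * (s - ax$j) > 0})"
  define \<alpha> \<alpha>' where "\<alpha> i s = sqrt (\<kappa>$i * (s - ax$i))"
    and "\<alpha>' i s = \<kappa>$i * inverse (sqrt (\<kappa>$i * (s - ax$i))) / 2" for i s
  have "open S"
    unfolding S_def by (intro open_INT ballI open_Collect_less continuous_intros) auto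
  moreover have "Cn_on n S (\<alpha> i)" for i n
    unfolding \<alpha>_def
    using Cn_on_mult[OF Cn_on_const Cn_on_add[OF Cn_on_ident Cn_on_const], of n S "\<kappa>$i" "- ax$i"]
    by (intro Cn_on_sqrt) (auto simp: S_def)
  moreover have "(\<alpha> i has_real_derivative \<alpha>' i s) (at s)" "(\<alpha> i s)\<^sup>2 = \<kappa>$i * (s - ax$i)" if "s \<in> S" for i s
  proof -
    have pos: "\<kappa>$i * (s - ax$i) > 0" using that by (simp add: S_def)
    show "(\<alpha> i s)\<^sup>2 = \<kappa>$i * (s - ax$i)" using pos by (simp add: \<alpha>_def)
    have "((\<lambda>s. \<kappa>$i * (s - ax$i)) has_real_derivative \<kappa>$i) (at s)"
      by (auto intro!: derivative_eq_intros)
    from DERIV_chain2[OF DERIV_real_sqrt[OF pos] this]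
    show "(\<alpha> i has_real_derivative \<alpha>' i s) (at s)"
      by (simp add: \<alpha>_def[abs_def] \<alpha>'_def mult_ac)
  qed
  ultimately have "regular_param \<kappa> S (\<lambda>s. s) (\<lambda>s. 1) \<alpha> \<alpha>'"
    by (simp add: regular_param_def)
  moreover have "u0 \<in> S" using \<kappa> False by (auto simp: S_def)
  ultimately show ?thesis using that by (auto simp: \<alpha>_def)
next
  case True
  then obtain i where i: "u0 = ax$i" by blast
  define u where "u s = ax$i + s * s / \<kappa>$i" for s
  define S where "S = (\<Inter>j. {s. j = i \<or> \<kappa>$j * (u s - ax$j) > 0})"
  define \<alpha> where "\<alpha> j s = (if j = i then s else sqrt (\<kappa>$j * (u s - ax$j)))" for j s
  define \<alpha>' where "\<alpha>' j s = (if j = i then 1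
    else \<kappa>$j * (2 * s / \<kappa>$i) * inverse (sqrt (\<kappa>$j * (u s - ax$j))) / 2)" for j s
  have du: "(u has_real_derivative 2 * s / \<kappa>$i) (at s)" for s
    unfolding u_def by (auto intro!: derivative_eq_intros simp: \<kappa>(1))
  have "open S"
  proof -
    have "open {s. j = i \<or> \<kappa>$j * (u s - ax$j) > 0}" for j
      unfolding u_def by (cases "j = i") (auto intro!: open_Collect_less continuous_intros simp: \<kappa>)
    then show ?thesis unfolding S_def by (intro open_INT) auto
  qed
  moreover have "Cn_on n S (\<alpha> j)" for j n
  proof (cases "j = i")
    case True
    then show ?thesis by (simp add: \<alpha>_def[abs_def] Cn_on_ident)
  next
    case False
    have "Cn_on n S (\<lambda>s. \<kappa>$j * (u s - ax$j))"
      using Cn_on_mult[OF Cn_on_const Cn_on_add[OF Cn_on_const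
            Cn_on_mult[OF Cn_on_mult[OF Cn_on_ident Cn_on_ident] Cn_on_const]],
          of n S "\<kappa>$j" "ax$i - ax$j" "1 / \<kappa>$i"]
      by (simp add: u_def algebra_simps)
    with False show ?thesis unfolding \<alpha>_def by (auto intro!: Cn_on_sqrt simp: S_def)
  qed
  moreover have "(\<alpha> j has_real_derivative \<alpha>' j s) (at s)" if "s \<in> S" for j s
  proof (cases "j = i")
    case True
    then show ?thesis by (simp add: \<alpha>_def[abs_def] \<alpha>'_def)
  next
    case False
    then have pos: "\<kappa>$j * (u s - ax$j) > 0" using that by (auto simp: S_def)
    have "((\<lambda>s. \<kappa>$j * (u s - ax$j)) has_real_derivative \<kappa>$j * (2 * s / \<kappa>$i)) (at s)"
      by (auto intro!: derivative_eq_intros du)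
    from DERIV_chain2[OF DERIV_real_sqrt[OF pos] this] False show ?thesis
      by (simp add: \<alpha>_def[abs_def] \<alpha>'_def mult_ac)
  qed
  moreover have "(\<alpha> j s)\<^sup>2 = \<kappa>$j * (u s - ax$j)" if "s \<in> S" for j s
  proof (cases "j = i")
    case True
    then show ?thesis using \<kappa>(1)[of i] by (simp add: \<alpha>_def u_def power2_eq_square)
  next
    case False
    then have "\<kappa>$j * (u s - ax$j) > 0" using that by (auto simp: S_def)
    with False show ?thesis by (simp add: \<alpha>_def)
  qed
  moreover have "2 * s / \<kappa>$i \<noteq> 0 \<or> (u s = ax$i \<and> \<alpha>' i s \<noteq> 0)" for s
    using \<kappa>(1)[of i] by (auto simp: u_def \<alpha>'_def)
  ultimately have "regular_param \<kappa> S u (\<lambda>s. 2 * s / \<kappa>$i) \<alpha> \<alpha>'"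
    unfolding regular_param_def using du by blast
  moreover have "0 \<in> S"
    using \<kappa>(2) i ax_inj by (auto simp: S_def u_def)
  moreover have "u 0 = u0" "\<alpha> j 0 = sqrt (\<kappa>$j * (u0 - ax$j))" for j
    by (simp_all add: u_def \<alpha>_def i)
  ultimately show ?thesis using that by blast
qed

text \<open>The sum is the divided difference of t at the three nodes a, b, c, which vanishes
  because t has degree one. It expresses orthogonality of the two coordinate directions.\<close>

lemma sum_inverse_M: "(\<Sum>i\<in>UNIV. 1 / M$i) = 0"
proof -
  define D where "D = (a - b) * (a - c) * (b - c)"
  have D: "D \<noteq> 0" using distinct by (simp add: D_def)
  have "b / ((b - a) * (b - c)) = - (b * (a - c)) / D"
    by (rule frac_eq_eq[THEN iffD2, OF _ D]) (use distinct in simp, unfold D_def, algebra)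
  moreover have "c / ((c - a) * (c - b)) = c * (a - b) / D"
    by (rule frac_eq_eq[THEN iffD2, OF _ D]) (use distinct in simp, unfold D_def, algebra)
  ultimately have "1 / M$1 = a * (b - c) / D" "1 / M$2 = - (b * (a - c)) / D" "1 / M$3 = c * (a - b) / D"
    using distinct by (simp_all add: M_simps D_def)
  then have "(\<Sum>i\<in>UNIV. 1 / M$i) = (a * (b - c) - b * (a - c) + c * (a - b)) / D"
    by (simp add: sum_3 add_divide_distrib diff_divide_distrib)
  also have "a * (b - c) - b * (a - c) + c * (a - b) = 0" by algebra
  finally show ?thesis by simp
qed

text \<open>Squaring the components and using the normalisation of \<kappa> and l gives the
  hypothesis of \<open>Q_from_roots\<close>, so \<open>u\<close> and \<open>v\<close> are the
  confocal coordinates. The factors satisfy the eigenvector relations, hence so do the partial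
  derivatives.\<close>

lemma separated_principal_chart:
  assumes S: "regular_param \<kappa> S u u' \<alpha> \<alpha>'" and T: "regular_param l T v v' \<beta> \<beta>'"
    and \<kappa>: "\<And>i. \<kappa>$i * l$i * M$i = 1"
    and s: "s \<in> S" and t: "t \<in> T" and less: "v t < u s"
  defines "\<psi> \<equiv> \<lambda>q. \<chi> i. \<alpha> i (fst q) * \<beta> i (snd q)"
  shows "principal_chart_at a b c (\<psi> (s, t)) \<psi> (s, t)"
proof -
  have nz: "\<kappa>$i \<noteq> 0" "l$i \<noteq> 0" for i using \<kappa>[of i] by auto
  \<comment> \<open>The condition v < u selects which root is \<open>croot 1\<close> and keeps the
    image away from umbilic points.\<close>
  define D where "D = {q \<in> S \<times> T. v (snd q) < u (fst q)}"
  have ST: "open S" "open T" using S T by (simp_all add: regular_param_def)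
  have "continuous_on S u" "continuous_on T v"
    using S T by (auto simp: regular_param_def intro!: continuous_at_imp_continuous_on DERIV_isCont)
  then have uv: "continuous_on (S \<times> T) (\<lambda>q. u (fst q))" "continuous_on (S \<times> T) (\<lambda>q. v (snd q))"
    by (auto intro: continuous_on_compose2[OF _ continuous_on_fst[OF continuous_on_id]]
        continuous_on_compose2[OF _ continuous_on_snd[OF continuous_on_id]])
  have "open D"
  proof -
    have "D = (S \<times> T) \<inter> (\<lambda>q. u (fst q) - v (snd q)) -` {0<..}" by (auto simp: D_def)
    moreover have "open \<dots>"
      using continuous_on_open_vimage[OF open_Times[OF ST]] continuous_on_diff[OF uv] open_greaterThan
      by (metis Int_commute)
    ultimately show ?thesis by simp
  qed
  have D: "fst q \<in> S" "snd q \<in> T" "v (snd q) < u (fst q)" if "q \<in> D" for q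
    using that by (auto simp: D_def)
  have q0: "(s, t) \<in> D" using s t less by (simp add: D_def)
  have "Ck_on n (S \<times> T) \<psi>" for n
    unfolding \<psi>_def using S T ST by (intro Ck_on_separated) (auto simp: regular_param_def)
  then have Ck: "Ck_on n D \<psi>" for n
    by (rule Ck_on_subset) (auto simp: D_def)
  have d: "du \<psi> q = (\<chi> i. \<alpha>' i (fst q) * \<beta> i (snd q))" "dv \<psi> q = (\<chi> i. \<alpha> i (fst q) * \<beta>' i (snd q))"
    if "q \<in> D" for q
    unfolding \<psi>_def
    using separated_derivatives(2,3)[of \<alpha> "\<lambda>i. \<alpha>' i (fst q)" q \<beta> "\<lambda>i. \<beta>' i (snd q)"] D[OF that] S T
    by (auto simp: regular_param_def)
  have roots: "\<psi> q \<in> Q" "croot 1 (\<psi> q) = u (fst q)" "croot (- 1) (\<psi> q) = v (snd q)" if "q \<in> D" for q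
  proof -
    have "(ax$i - u (fst q)) * (ax$i - v (snd q)) = M$i * (\<psi> q $ i)\<^sup>2" for i
    proof -
      have "M$i * (\<psi> q $ i)\<^sup>2 = (\<kappa>$i * l$i * M$i) * ((u (fst q) - ax$i) * (v (snd q) - ax$i))"
        using S T D[OF that] by (simp add: \<psi>_def power_mult_distrib regular_param_def)
      moreover have "(ax$i - u (fst q)) * (ax$i - v (snd q)) = (u (fst q) - ax$i) * (v (snd q) - ax$i)"
        by (simp add: algebra_simps)
      ultimately show ?thesis by (simp only: \<kappa> mult_1)
    qed
    note r = Q_from_roots[OF this]
    show "\<psi> q \<in> Q" by (rule r)
    show "croot 1 (\<psi> q) = u (fst q)" "croot (- 1) (\<psi> q) = v (snd q)"
      using root_unique[OF r(2,3)] D[OF that] by simp_all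
  qed
  have diff: "\<psi> differentiable_on D" using Ck[of "Suc 0"] by simp
  have eig: "- du (unit_normal a b c \<circ> \<psi>) q = curv1 a b c (\<psi> q) *\<^sub>R du \<psi> q"
    "- dv (unit_normal a b c \<circ> \<psi>) q = curv2 a b c (\<psi> q) *\<^sub>R dv \<psi> q" if q: "q \<in> D" for q
  proof -
    have "- vector_derivative (unit_normal a b c \<circ> (\<lambda>r. \<psi> (r, snd q))) (at (fst q)) =
        curv 1 (\<psi> (fst q, snd q)) *\<^sub>R du \<psi> q"
    proof (rule principal_direction)
      show "((\<lambda>r. \<psi> (r, snd q)) has_vector_derivative du \<psi> q) (at (fst q))"
        using slice_fst_has_vector_derivative[OF diff \<open>open D\<close>, of "fst q" "snd q"] q by simp
      show "eventually (\<lambda>r. \<psi> (r, snd q) \<in> Q) (nhds (fst q))"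
        using slice_fst_eventually[OF \<open>open D\<close> q] by eventually_elim (rule roots)
      show "du \<psi> q $ i * (croot 1 (\<psi> (fst q, snd q)) - ax$i) = u' (fst q) / 2 * \<psi> (fst q, snd q) $ i" for i
        \<comment> \<open>The relation for \<alpha>_i is multiplied by \<beta>_i, which is constant
          along this coordinate line.\<close>
        using arg_cong[OF regular_param_eigen[OF S D(1)[OF q] nz(1), of i], of "\<lambda>x. x * \<beta> i (snd q)"]
        unfolding d(1)[OF q] prod.collapse roots(2)[OF q]
        by (simp only: \<psi>_def vec_lambda_beta mult_ac)
    qed simp
    then show "- du (unit_normal a b c \<circ> \<psi>) q = curv1 a b c (\<psi> q) *\<^sub>R du \<psi> q"
      using roots(1)[OF q] by (simp add: du_def o_def curv1_eq)
    have "- vector_derivative (unit_normal a b c \<circ> (\<lambda>r. \<psi> (fst q, r))) (at (snd q)) =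
        curv (- 1) (\<psi> (fst q, snd q)) *\<^sub>R dv \<psi> q"
    proof (rule principal_direction)
      show "((\<lambda>r. \<psi> (fst q, r)) has_vector_derivative dv \<psi> q) (at (snd q))"
        using slice_snd_has_vector_derivative[OF diff \<open>open D\<close>, of "fst q" "snd q"] q by simp
      show "eventually (\<lambda>r. \<psi> (fst q, r) \<in> Q) (nhds (snd q))"
        using slice_snd_eventually[OF \<open>open D\<close> q] by eventually_elim (rule roots)
      show "dv \<psi> q $ i * (croot (- 1) (\<psi> (fst q, snd q)) - ax$i) = v' (snd q) / 2 * \<psi> (fst q, snd q) $ i" for i
        using arg_cong[OF regular_param_eigen[OF T D(2)[OF q] nz(2), of i], of "\<lambda>x. x * \<alpha> i (fst q)"]
        unfolding d(2)[OF q] prod.collapse roots(3)[OF q]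
        by (simp only: \<psi>_def vec_lambda_beta mult_ac)
    qed simp
    then show "- dv (unit_normal a b c \<circ> \<psi>) q = curv2 a b c (\<psi> q) *\<^sub>R dv \<psi> q"
      using roots(1)[OF q] by (simp add: dv_def o_def curv2_eq)
  qed
  \<comment> \<open>Stated for an arbitrary pair of parameters, to serve both partial derivatives.
    If x' vanishes, then x is an axis i at which \<xi>'_i is nonzero, and \<eta>_i is nonzero
    because y differs from x. Otherwise every \<xi>'_i is nonzero, and y cannot equal both a and
    b.\<close>
  have factor_nz: "\<exists>i. \<xi>' i r * \<eta> i r' \<noteq> 0"
    if X: "regular_param k X x x' \<xi> \<xi>'" and Y: "regular_param k' Y y y' \<eta> \<eta>'"
      and r: "r \<in> X" "r' \<in> Y" and ne: "x r \<noteq> y r'" and k: "\<And>i. k$i \<noteq> 0" "\<And>i. k'$i \<noteq> 0"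
    for k k' X Y x x' y y' \<xi> \<xi>' \<eta> \<eta>' r r'
  proof -
    have \<eta>: "\<eta> i r' \<noteq> 0" if "y r' \<noteq> ax$i" for i
    proof -
      have "(\<eta> i r')\<^sup>2 \<noteq> 0" using Y r(2) that k(2)[of i] by (auto simp: regular_param_def)
      then show ?thesis by simp
    qed
    show ?thesis
    proof (cases "x' r = 0")
      case True
      then obtain i where "x r = ax$i" "\<xi>' i r \<noteq> 0" using X r(1) by (auto simp: regular_param_def)
      then show ?thesis using \<eta>[of i] ne by auto
    next
      case False
      obtain i where "y r' \<noteq> ax$i" using distinct(4) by (metis ax_simps(1,2))
      moreover have "\<xi>' i r \<noteq> 0" using regular_param_deriv[OF X r(1), of i] False k(1)[of i] by auto
      ultimately show ?thesis using \<eta>[of i] by auto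
    qed
  qed
  have cross: "cross3 (du \<psi> q) (dv \<psi> q) \<noteq> 0" if q: "q \<in> D" for q
  proof -
    have "du \<psi> q \<noteq> 0"
      using factor_nz[OF S T D(1,2)[OF q] _ nz] D(3)[OF q] by (auto simp: d[OF q] vec_eq_iff)
    moreover have "dv \<psi> q \<noteq> 0"
      using factor_nz[OF T S D(2,1)[OF q] _ nz(2,1)] D(3)[OF q] by (auto simp: d[OF q] vec_eq_iff mult.commute)
    \<comment> \<open>Each summand is one common factor times 1/M_i. Two nonzero orthogonal vectors
      then have a nonzero cross product.\<close>
    moreover have "du \<psi> q \<bullet> dv \<psi> q = 0"
    proof -
      have "\<alpha>' i (fst q) * \<beta> i (snd q) * (\<alpha> i (fst q) * \<beta>' i (snd q)) = u' (fst q) * v' (snd q) / 4 * (1 / M$i)" for i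
      proof -
        have "4 * (\<alpha>' i (fst q) * \<beta> i (snd q) * (\<alpha> i (fst q) * \<beta>' i (snd q))) = (\<kappa>$i * l$i) * (u' (fst q) * v' (snd q))"
          using regular_param_deriv[OF S D(1)[OF q], of i] regular_param_deriv[OF T D(2)[OF q], of i] by algebra
        moreover have "\<kappa>$i * l$i = 1 / M$i" using \<kappa>[of i] M_nz[of i] by (simp add: field_simps)
        ultimately show ?thesis by simp
      qed
      then have "du \<psi> q \<bullet> dv \<psi> q = u' (fst q) * v' (snd q) / 4 * (\<Sum>i\<in>UNIV. 1 / M$i)"
        unfolding d[OF q] inner_vec_def sum_distrib_left by simp
      then show ?thesis by (simp only: sum_inverse_M)
    qed
    ultimately show ?thesis
      using norm_cross_dot[of "du \<psi> q" "dv \<psi> q"] by auto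
  qed
  \<comment> \<open>The product map need not be injective on all of \<open>D\<close>, so the domain
    is shrunk to a ball around the base point.\<close>
  obtain r where r: "r > 0" "ball (s, t) r \<subseteq> D" "inj_on \<psi> (ball (s, t) r)"
    using immersion_locally_injective[OF \<open>open D\<close> q0 _ cross[OF q0]] Ck by metis
  have "principal_chart a b c (ball (s, t) r) \<psi>"
    unfolding principal_chart_def smooth2_on_def
    using r Ck_on_subset[OF Ck r(2)] roots(1) cross eig by auto
  then show ?thesis using r(1) by (auto simp: principal_chart_at_def)
qed

text \<open>It remains to choose constants with \<kappa>_i l_i M_i = 1 that make both families of
  radicands nonnegative at the roots of the point.\<close>

lemma exists_principal_chart:
  assumes p: "p \<in> Q" "p \<notin> umbilics a b c"
  obtains \<psi> q where "principal_chart_at a b c p \<psi> q"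
proof -
  define U V where "U = croot 1 p" and "V = croot (- 1) p"
  have less: "V < U"
    using root_le[OF p(1)] root_eq_iff[OF p(1), of 1] p by (simp add: umbilics_iff U_def V_def)
  have ax: "(U - ax$i) * (V - ax$i) = M$i * (p$i)\<^sup>2" for i
    using root_axis[OF p(1), of 1 i] by (simp add: U_def V_def)
  \<comment> \<open>Taking \<kappa>_i = U - a_i makes its radicand a square, and l_i is then forced.
    When U = a_i the radicand of \<kappa>_i is zero anyway, so l_i is chosen as V - a_i and
    \<kappa>_i is forced.\<close>
  define \<kappa> l :: "real^3" where
    "\<kappa> = (\<chi> i. if U = ax$i then 1 / ((V - ax$i) * M$i) else U - ax$i)" and
    "l = (\<chi> i. if U = ax$i then V - ax$i else 1 / ((U - ax$i) * M$i))"
  have \<kappa>: "\<kappa>$i * l$i * M$i = 1" for i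
    using M_nz[of i] less by (auto simp: \<kappa>_def l_def)
  then have nz: "\<kappa>$i \<noteq> 0" "l$i \<noteq> 0" for i by (metis mult_zero_left mult_zero_right zero_neq_one)+
  have \<kappa>_pos: "\<kappa>$i * (U - ax$i) > 0" if "U \<noteq> ax$i" for i
    using that by (auto simp: \<kappa>_def zero_less_mult_iff linorder_neq_iff)
  have l_pos: "l$i * (V - ax$i) > 0" if "V \<noteq> ax$i" for i
  proof (cases "U = ax$i")
    case True
    then show ?thesis using that by (auto simp: l_def zero_less_mult_iff linorder_neq_iff)
  next
    case False
    have "l$i * (V - ax$i) = (V - ax$i) * (U - ax$i) / (M$i * (U - ax$i)\<^sup>2)"
      using False M_nz[of i] by (simp add: l_def power2_eq_square)
    also have "\<dots> = (p$i)\<^sup>2 / (U - ax$i)\<^sup>2"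
      using ax[of i] M_nz[of i] by (simp add: mult.commute)
    finally have "l$i * (V - ax$i) = (p$i)\<^sup>2 / (U - ax$i)\<^sup>2" .
    moreover have "p$i \<noteq> 0" using ax[of i] False that by auto
    ultimately show ?thesis using False by simp
  qed
  obtain S u u' \<alpha> \<alpha>' s where S: "regular_param \<kappa> S u u' \<alpha> \<alpha>'" "s \<in> S" "u s = U"
    "\<And>i. \<alpha> i s = sqrt (\<kappa>$i * (U - ax$i))"
    by (rule exists_regular_param[OF nz(1) \<kappa>_pos]) blast+
  obtain T v v' \<beta> \<beta>' t where T: "regular_param l T v v' \<beta> \<beta>'" "t \<in> T" "v t = V"
    "\<And>i. \<beta> i t = sqrt (l$i * (V - ax$i))"
    by (rule exists_regular_param[OF nz(2) l_pos]) blast+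
  \<comment> \<open>The parameters take nonnegative values at the base point; the signs of the
    coordinates are put into the first family of factors.\<close>
  define \<sigma> :: "3 \<Rightarrow> real" where "\<sigma> i = (if p$i \<ge> 0 then 1 else - 1)" for i
  have \<sigma>: "\<sigma> i \<noteq> 0" "(\<sigma> i)\<^sup>2 = 1" for i by (simp_all add: \<sigma>_def)
  have S': "regular_param \<kappa> S u u' (\<lambda>i s. \<sigma> i * \<alpha> i s) (\<lambda>i s. \<sigma> i * \<alpha>' i s)"
    using S(1) \<sigma> unfolding regular_param_def
    by (auto simp: power_mult_distrib intro!: Cn_on_mult Cn_on_const DERIV_cmult)
  have "\<sigma> i * \<alpha> i s * \<beta> i t = p$i" for i
  proof -
    have "\<alpha> i s * \<beta> i t = sqrt ((\<kappa>$i * l$i) * ((U - ax$i) * (V - ax$i)))"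
      by (simp add: S(4) T(4) real_sqrt_mult mult_ac)
    also have "(\<kappa>$i * l$i) * ((U - ax$i) * (V - ax$i)) = (p$i)\<^sup>2"
      unfolding ax using \<kappa>[of i] by (metis mult.assoc mult_1)
    finally show ?thesis by (simp add: mult.assoc \<sigma>_def)
  qed
  then have "(\<chi> i. \<sigma> i * \<alpha> i s * \<beta> i t) = p" by (simp add: vec_eq_iff)
  with separated_principal_chart[OF S' T(1) \<kappa> S(2) T(2)] less S(3) T(3) that show ?thesis
    by auto
qed

subsection \<open>Ridges and umbilic points of the three kinds of quadrics\<close>

text \<open>The definition asks for some chart: \<open>ridge1_in_chart\<close> gives the same answer
  in all of them and \<open>exists_principal_chart\<close> supplies one.\<close>

lemma ridge1_iff:
  "p \<in> ridge1 a b c \<longleftrightarrow> p \<in> Q \<and> p \<notin> umbilics a b c \<and> (\<exists>i. croot 1 p = ax$i)"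
proof
  assume "p \<in> ridge1 a b c"
  then obtain \<psi> q where p: "p \<in> Q" "p \<notin> umbilics a b c"
    and "principal_chart_at a b c p \<psi> q" "du (curv1 a b c \<circ> \<psi>) q = 0"
    unfolding ridge1_def by blast
  then show "p \<in> Q \<and> p \<notin> umbilics a b c \<and> (\<exists>i. croot 1 p = ax$i)"
    using ridge1_in_chart(1) by blast
next
  assume p: "p \<in> Q \<and> p \<notin> umbilics a b c \<and> (\<exists>i. croot 1 p = ax$i)"
  then obtain \<psi> q where "principal_chart_at a b c p \<psi> q"
    using exists_principal_chart by blast
  moreover from this have "du (curv1 a b c \<circ> \<psi>) q = 0"
    using ridge1_in_chart(1) p by blast
  ultimately show "p \<in> ridge1 a b c"
    using p unfolding ridge1_def by blast
qed

lemma ridge2_iff: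
  "p \<in> ridge2 a b c \<longleftrightarrow> p \<in> Q \<and> p \<notin> umbilics a b c \<and> (\<exists>i. croot (- 1) p = ax$i)"
proof
  assume "p \<in> ridge2 a b c"
  then obtain \<psi> q where p: "p \<in> Q" "p \<notin> umbilics a b c"
    and "principal_chart_at a b c p \<psi> q" "dv (curv2 a b c \<circ> \<psi>) q = 0"
    unfolding ridge2_def by blast
  then show "p \<in> Q \<and> p \<notin> umbilics a b c \<and> (\<exists>i. croot (- 1) p = ax$i)"
    using ridge2_in_chart(1) by blast
next
  assume p: "p \<in> Q \<and> p \<notin> umbilics a b c \<and> (\<exists>i. croot (- 1) p = ax$i)"
  then obtain \<psi> q where "principal_chart_at a b c p \<psi> q"
    using exists_principal_chart by blast
  moreover from this have "dv (curv2 a b c \<circ> \<psi>) q = 0"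
    using ridge2_in_chart(1) p by blast
  ultimately show "p \<in> ridge2 a b c"
    using p unfolding ridge2_def by blast
qed

section \<open>Sign criteria for the type of a ridge\<close>

lemma zigzag1I:
  assumes "p \<in> Q" "p \<notin> umbilics a b c" "croot 1 p = ax$i" "M$i * ax$i * croot (- 1) p > 0"
  shows "p \<in> ridge1 a b c" "p \<in> zigzag1 a b c"
proof -
  show r: "p \<in> ridge1 a b c" using assms unfolding ridge1_iff by blast
  have "sigma1 a b c \<psi> q < 0" if chart: "principal_chart_at a b c p \<psi> q" for \<psi> q
  proof -
    obtain k where "k > 0" "sigma1 a b c \<psi> q = - k * (M$i * ax$i * croot (- 1) p)"
      using ridge1_in_chart(2)[OF chart assms(2,3)] by blast
    with assms(4) show ?thesis by (simp add: mult_pos_neg)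
  qed
  with r show "p \<in> zigzag1 a b c" unfolding zigzag1_def by blast
qed

lemma beak1I:
  assumes "p \<in> Q" "p \<notin> umbilics a b c" "croot 1 p = ax$i" "M$i * ax$i * croot (- 1) p < 0"
  shows "p \<in> ridge1 a b c" "p \<in> beak_to_beak1 a b c"
proof -
  show r: "p \<in> ridge1 a b c" using assms unfolding ridge1_iff by blast
  have "sigma1 a b c \<psi> q > 0" if chart: "principal_chart_at a b c p \<psi> q" for \<psi> q
  proof -
    obtain k where "k > 0" "sigma1 a b c \<psi> q = - k * (M$i * ax$i * croot (- 1) p)"
      using ridge1_in_chart(2)[OF chart assms(2,3)] by blast
    with assms(4) show ?thesis by (simp add: mult_pos_neg)
  qed
  with r show "p \<in> beak_to_beak1 a b c" unfolding beak_to_beak1_def by blast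
qed

lemma zigzag2I:
  assumes "p \<in> Q" "p \<notin> umbilics a b c" "croot (- 1) p = ax$i" "M$i * ax$i * croot 1 p > 0"
  shows "p \<in> ridge2 a b c" "p \<in> zigzag2 a b c"
proof -
  show r: "p \<in> ridge2 a b c" using assms unfolding ridge2_iff by blast
  have "sigma2 a b c \<psi> q < 0" if chart: "principal_chart_at a b c p \<psi> q" for \<psi> q
  proof -
    obtain k where "k > 0" "sigma2 a b c \<psi> q = - k * (M$i * ax$i * croot 1 p)"
      using ridge2_in_chart(2)[OF chart assms(2,3)] by blast
    with assms(4) show ?thesis by (simp add: mult_pos_neg)
  qed
  with r show "p \<in> zigzag2 a b c" unfolding zigzag2_def by blast
qed

lemma beak2I:
  assumes "p \<in> Q" "p \<notin> umbilics a b c" "croot (- 1) p = ax$i" "M$i * ax$i * croot 1 p < 0"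
  shows "p \<in> ridge2 a b c" "p \<in> beak_to_beak2 a b c"
proof -
  show r: "p \<in> ridge2 a b c" using assms unfolding ridge2_iff by blast
  have "sigma2 a b c \<psi> q > 0" if chart: "principal_chart_at a b c p \<psi> q" for \<psi> q
  proof -
    obtain k where "k > 0" "sigma2 a b c \<psi> q = - k * (M$i * ax$i * croot 1 p)"
      using ridge2_in_chart(2)[OF chart assms(2,3)] by blast
    with assms(4) show ?thesis by (simp add: mult_pos_neg)
  qed
  with r show "p \<in> beak_to_beak2 a b c" unfolding beak_to_beak2_def by blast
qed

lemma umbilics_iff_roots_eq: "p \<in> umbilics a b c \<longleftrightarrow> p \<in> Q \<and> croot 1 p = croot (- 1) p"
  using umbilics_iff root_eq_iff[of p 1] by auto

lemma plane_iff:
  assumes "p \<in> Q"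
  shows "p$i = 0 \<longleftrightarrow> croot 1 p = ax$i \<or> croot (- 1) p = ax$i"
  using root_axis[OF assms, of 1 i] M_nz[of i] by auto

lemma plane_subset_ridges:
  assumes "p \<in> Q" "p$i = 0" "p \<notin> umbilics a b c"
  shows "p \<in> ridge1 a b c \<union> ridge2 a b c"
  using assms by (auto simp: ridge1_iff ridge2_iff plane_iff)

lemma ridge_set_eq:
  "ridge_set a b c = (sec_xy a b c \<union> sec_xz a b c \<union> sec_yz a b c) - umbilics a b c"
proof -
  have "p \<in> ridge_set a b c \<longleftrightarrow> p \<in> Q \<and> p \<notin> umbilics a b c \<and> (\<exists>i. p$i = 0)" for p
    by (auto simp: ridge_set_def ridge1_iff ridge2_iff plane_iff)
  moreover have "(\<exists>i. p$i = 0) \<longleftrightarrow> p$1 = 0 \<or> p$2 = 0 \<or> p$3 = 0" for p :: "real^3"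
    using forall_3[of "\<lambda>i. p$i \<noteq> 0"] by blast
  ultimately show ?thesis by (auto simp: sec_xy_def sec_xz_def sec_yz_def)
qed

text \<open>Multiplication by the axis leaves the product of its differences to the other two, whose
  sign depends only on c < b < a and so is common to the three kinds.\<close>

lemma M_ax_sgn: "M$1 * a > 0" "M$2 * b < 0" "M$3 * c > 0"
  using distinct by (simp_all add: M_simps mult_neg_neg mult_neg_pos)

text \<open>If the axis a_j always separates the roots, they can coincide only at a_j. Then
  \<open>root_axis\<close> and its converse \<open>Q_from_roots\<close> describe the umbilic points
  by their squared coordinates.\<close>

lemma umbilics_middle:
  assumes "\<And>p. p \<in> Q \<Longrightarrow> croot (- 1) p \<le> ax$j \<and> ax$j \<le> croot 1 p"
  shows "p \<in> umbilics a b c \<longleftrightarrow> (\<forall>i. (ax$i - ax$j)\<^sup>2 = M$i * (p$i)\<^sup>2)"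
proof
  assume "p \<in> umbilics a b c"
  then have "p \<in> Q" "croot 1 p = ax$j" "croot (- 1) p = ax$j"
    using assms[of p] by (auto simp: umbilics_iff_roots_eq)
  then show "\<forall>i. (ax$i - ax$j)\<^sup>2 = M$i * (p$i)\<^sup>2"
    using root_axis[of p 1] by (simp add: power2_eq_square algebra_simps)
next
  assume "\<forall>i. (ax$i - ax$j)\<^sup>2 = M$i * (p$i)\<^sup>2"
  then have "(ax$i - ax$j) * (ax$i - ax$j) = M$i * (p$i)\<^sup>2" for i by (simp add: power2_eq_square)
  note r = Q_from_roots[OF this]
  show "p \<in> umbilics a b c"
    using r(1) root_unique[OF r(2,3)] by (simp add: umbilics_iff_roots_eq)
qed

text \<open>One root equals a_j, so (a - u)(a - v) is a - a_j times the distance from the other root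
  to a. Comparison with its value (a - a_j)^2 at |x| = x0 decides on which side of a_j the other
  root lies.\<close>

lemma middle_section:
  assumes p: "p \<in> Q" "p$j = 0"
    and mid: "croot (- 1) p \<le> ax$j" "ax$j \<le> croot 1 p" and j: "ax$j < a"
    and M1: "M$1 > 0" and x0: "x0 \<ge> 0" "M$1 * x0\<^sup>2 = (a - ax$j)\<^sup>2"
  shows "\<bar>p$1\<bar> > x0 \<Longrightarrow> croot 1 p = ax$j \<and> croot (- 1) p < ax$j"
    and "\<bar>p$1\<bar> < x0 \<Longrightarrow> croot (- 1) p = ax$j \<and> ax$j < croot 1 p"
proof -
  define d where "d = a - ax$j"
  have d: "d > 0" using j by (simp add: d_def)
  have UV: "(a - croot 1 p) * (a - croot (- 1) p) = M$1 * (p$1)\<^sup>2"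
    using root_axis[OF p(1), of 1 1] by (simp add: algebra_simps)
  have or: "croot 1 p = ax$j \<or> croot (- 1) p = ax$j"
    using plane_iff[OF p(1)] p(2) by blast
  {
    assume "\<bar>p$1\<bar> > x0"
    then have "x0\<^sup>2 < (p$1)\<^sup>2" using x0(1) abs_le_square_iff[of "p$1" x0] by (auto simp: not_le)
    then have gt: "d * d < (a - croot 1 p) * (a - croot (- 1) p)"
      using M1 by (simp add: UV x0(2)[symmetric] d_def power2_eq_square[symmetric])
    show "croot 1 p = ax$j \<and> croot (- 1) p < ax$j"
      using or
    proof
      assume "croot 1 p = ax$j"
      with gt d show ?thesis by (simp add: d_def)
    next
      assume V: "croot (- 1) p = ax$j"
      with gt d have "d < a - croot 1 p" by (simp add: d_def)
      with mid(2) show ?thesis by (simp add: d_def)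
    qed
  next
    assume "\<bar>p$1\<bar> < x0"
    then have "(p$1)\<^sup>2 < x0\<^sup>2" using x0(1) abs_le_square_iff[of x0 "p$1"] by (auto simp: not_le)
    then have lt: "(a - croot 1 p) * (a - croot (- 1) p) < d * d"
      using M1 by (simp add: UV x0(2)[symmetric] d_def power2_eq_square[symmetric])
    show "croot (- 1) p = ax$j \<and> ax$j < croot 1 p"
      using or
    proof
      assume "croot 1 p = ax$j"
      with lt d have "a - croot (- 1) p < d" by (simp add: d_def)
      with mid(1) show ?thesis by (simp add: d_def)
    next
      assume V: "croot (- 1) p = ax$j"
      with lt d show ?thesis by (simp add: d_def)
    qed
  }
qed

section \<open>Reading off the ridges of each kind of quadric\<close>

lemma ellipsoid_ridges:
  assumes k: "is_ellipsoid a b c"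
  defines "x0 \<equiv> sqrt (a * (a - b) / (a - c))" and "z0 \<equiv> sqrt (c * (b - c) / (a - c))"
  shows "sec_xy a b c \<subseteq> ridge2 a b c" "sec_xy a b c \<subseteq> zigzag2 a b c"
    and "sec_yz a b c \<subseteq> ridge1 a b c" "sec_yz a b c \<subseteq> zigzag1 a b c"
    and "umbilics a b c = {vector [x0, 0, z0], vector [x0, 0, -z0], vector [-x0, 0, z0], vector [-x0, 0, -z0]}"
    and "card (umbilics a b c) = 4"
    and "umbilics a b c \<subseteq> sec_xz a b c"
    and "sec_xz a b c - umbilics a b c \<subseteq> ridge1 a b c \<union> ridge2 a b c"
    and "\<forall>p \<in> sec_xz a b c. \<bar>p$1\<bar> > x0 \<longrightarrow> p \<in> ridge1 a b c \<and> p \<in> beak_to_beak1 a b c"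
    and "\<forall>p \<in> sec_xz a b c. \<bar>p$1\<bar> < x0 \<longrightarrow> p \<in> ridge2 a b c \<and> p \<in> beak_to_beak2 a b c"
proof -
  have lt: "0 < c" "c < b" "b < a" using k by (auto simp: is_ellipsoid_def)
  have rng: "b \<le> croot 1 p" "croot 1 p \<le> a" "c \<le> croot (- 1) p" "croot (- 1) p \<le> b" if "p \<in> Q" for p
    using root_range(1)[OF that k] by auto
  have "p \<in> ridge2 a b c \<and> p \<in> zigzag2 a b c" if "p \<in> sec_xy a b c" for p
  proof -
    have p: "p \<in> Q" "p$3 = 0" using that by (auto simp: sec_xy_def)
    \<comment> \<open>On z = 0 one of the roots equals c, and u is at least b > c.\<close>
    have "croot (- 1) p = ax$3" using plane_iff[OF p(1), of 3] p(2) rng[OF p(1)] lt by auto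
    then show ?thesis
      using zigzag2I[OF p(1), of 3] M_ax_sgn(3) rng[OF p(1)] lt by (simp add: umbilics_iff_roots_eq)
  qed
  then show "sec_xy a b c \<subseteq> ridge2 a b c" "sec_xy a b c \<subseteq> zigzag2 a b c" by blast+
  have "p \<in> ridge1 a b c \<and> p \<in> zigzag1 a b c" if "p \<in> sec_yz a b c" for p
  proof -
    have p: "p \<in> Q" "p$1 = 0" using that by (auto simp: sec_yz_def)
    have "croot 1 p = ax$1" using plane_iff[OF p(1), of 1] p(2) rng[OF p(1)] lt by auto
    then show ?thesis
      using zigzag1I[OF p(1), of 1] M_ax_sgn(1) rng[OF p(1)] lt by (simp add: umbilics_iff_roots_eq)
  qed
  then show "sec_yz a b c \<subseteq> ridge1 a b c" "sec_yz a b c \<subseteq> zigzag1 a b c" by blast+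
  have x0: "x0 > 0" "x0\<^sup>2 = a * (a - b) / (a - c)" and z0: "z0 > 0" "z0\<^sup>2 = c * (b - c) / (a - c)"
    using lt by (simp_all add: x0_def z0_def)
  \<comment> \<open>The equations of \<open>umbilics_middle\<close> for the separating axis b, at
    the first and third coordinates.\<close>
  have mx0: "M$1 * x0\<^sup>2 = (a - b)\<^sup>2" and mz0: "M$3 * z0\<^sup>2 = (c - b)\<^sup>2"
    using lt unfolding x0 z0 M_simps by (simp_all add: field_simps power2_eq_square)
  have umb: "p \<in> umbilics a b c \<longleftrightarrow> (p$1)\<^sup>2 = x0\<^sup>2 \<and> p$2 = 0 \<and> (p$3)\<^sup>2 = z0\<^sup>2" for p
    using umbilics_middle[of 2 p] rng M_nz
    by (auto simp: forall_3 mx0[symmetric] mz0[symmetric])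
  show u: "umbilics a b c = {vector [x0, 0, z0], vector [x0, 0, -z0], vector [-x0, 0, z0], vector [-x0, 0, -z0]}"
    by (auto simp: umb vec_eq_iff forall_3 power2_eq_iff)
  show "card (umbilics a b c) = 4"
    unfolding u using x0(1) z0(1) by (simp add: vec_eq_iff forall_3)
  show "umbilics a b c \<subseteq> sec_xz a b c"
    by (auto simp: umb sec_xz_def dest: umbilics_iff_roots_eq[THEN iffD1])
  show "sec_xz a b c - umbilics a b c \<subseteq> ridge1 a b c \<union> ridge2 a b c"
    using plane_subset_ridges[of _ 2] by (auto simp: sec_xz_def)
  have mid: "x0 < \<bar>p$1\<bar> \<Longrightarrow> croot 1 p = ax$2 \<and> croot (- 1) p < ax$2"
    "\<bar>p$1\<bar> < x0 \<Longrightarrow> croot (- 1) p = ax$2 \<and> ax$2 < croot 1 p" if "p \<in> sec_xz a b c" for p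
    using middle_section[of p 2 x0] that rng[of p] lt x0(1) mx0 M_sgn(1)[OF k] by (auto simp: sec_xz_def)
  show "\<forall>p \<in> sec_xz a b c. \<bar>p$1\<bar> > x0 \<longrightarrow> p \<in> ridge1 a b c \<and> p \<in> beak_to_beak1 a b c"
  proof (intro ballI impI)
    fix p assume p: "p \<in> sec_xz a b c" "\<bar>p$1\<bar> > x0"
    then have "p \<in> Q" by (simp add: sec_xz_def)
    then show "p \<in> ridge1 a b c \<and> p \<in> beak_to_beak1 a b c"
      using beak1I[of p 2] mid(1)[OF p] rng[of p] lt M_ax_sgn(2)
      by (simp add: umbilics_iff_roots_eq mult_neg_pos)
  qed
  show "\<forall>p \<in> sec_xz a b c. \<bar>p$1\<bar> < x0 \<longrightarrow> p \<in> ridge2 a b c \<and> p \<in> beak_to_beak2 a b c"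
  proof (intro ballI impI)
    fix p assume p: "p \<in> sec_xz a b c" "\<bar>p$1\<bar> < x0"
    then have "p \<in> Q" by (simp add: sec_xz_def)
    then show "p \<in> ridge2 a b c \<and> p \<in> beak_to_beak2 a b c"
      using beak2I[of p 2] mid(2)[OF p] rng[of p] lt M_ax_sgn(2)
      by (simp add: umbilics_iff_roots_eq mult_neg_pos)
  qed
qed

text \<open>Here v <= c < 0 < b <= u, so the roots never meet and each section is a ridge of a
  single curvature along its whole length.\<close>

lemma one_sheet_ridges:
  assumes k: "is_one_sheet a b c"
  shows "sec_yz a b c \<subseteq> ridge1 a b c" "sec_yz a b c \<subseteq> beak_to_beak1 a b c"
    and "sec_xz a b c \<subseteq> ridge1 a b c" "sec_xz a b c \<subseteq> zigzag1 a b c"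
    and "sec_xy a b c \<subseteq> ridge2 a b c" "sec_xy a b c \<subseteq> zigzag2 a b c"
proof -
  have lt: "c < 0" "0 < b" "b < a" using k by (auto simp: is_one_sheet_def)
  have rng: "b \<le> croot 1 p" "croot 1 p \<le> a" "croot (- 1) p \<le> c" if "p \<in> Q" for p
    using root_range(2)[OF that k] by auto
  have "p \<in> ridge1 a b c \<and> p \<in> beak_to_beak1 a b c" if "p \<in> sec_yz a b c" for p
  proof -
    have p: "p \<in> Q" "p$1 = 0" using that by (auto simp: sec_yz_def)
    have "croot 1 p = ax$1" using plane_iff[OF p(1), of 1] p(2) rng[OF p(1)] lt by auto
    then show ?thesis
      using beak1I[OF p(1), of 1] M_ax_sgn(1) rng[OF p(1)] lt by (simp add: umbilics_iff_roots_eq mult_pos_neg)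
  qed
  then show "sec_yz a b c \<subseteq> ridge1 a b c" "sec_yz a b c \<subseteq> beak_to_beak1 a b c" by blast+
  have "p \<in> ridge1 a b c \<and> p \<in> zigzag1 a b c" if "p \<in> sec_xz a b c" for p
  proof -
    have p: "p \<in> Q" "p$2 = 0" using that by (auto simp: sec_xz_def)
    have "croot 1 p = ax$2" using plane_iff[OF p(1), of 2] p(2) rng[OF p(1)] lt by auto
    then show ?thesis
      using zigzag1I[OF p(1), of 2] M_ax_sgn(2) rng[OF p(1)] lt by (simp add: umbilics_iff_roots_eq mult_neg_neg)
  qed
  then show "sec_xz a b c \<subseteq> ridge1 a b c" "sec_xz a b c \<subseteq> zigzag1 a b c" by blast+
  have "p \<in> ridge2 a b c \<and> p \<in> zigzag2 a b c" if "p \<in> sec_xy a b c" for p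
  proof -
    have p: "p \<in> Q" "p$3 = 0" using that by (auto simp: sec_xy_def)
    have "croot (- 1) p = ax$3" using plane_iff[OF p(1), of 3] p(2) rng[OF p(1)] lt by auto
    then show ?thesis
      using zigzag2I[OF p(1), of 3] M_ax_sgn(3) rng[OF p(1)] lt by (simp add: umbilics_iff_roots_eq)
  qed
  then show "sec_xy a b c \<subseteq> ridge2 a b c" "sec_xy a b c \<subseteq> zigzag2 a b c" by blast+
qed

text \<open>The axis separating the roots is now c, so the section with umbilic points is z = 0. The
  values \<open>x0\<close> and \<open>y0\<close> solve the equations of
  \<open>umbilics_middle\<close> for this axis.\<close>

lemma two_sheets_ridges:
  assumes k: "is_two_sheets a b c"
  defines "x0 \<equiv> sqrt (a * (a - c) / (a - b))" and "y0 \<equiv> sqrt (b * (b - c) / (b - a))"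
  shows "sec_xz a b c \<subseteq> ridge1 a b c" "sec_xz a b c \<subseteq> zigzag1 a b c"
    and "x0 > 0" "y0 > 0"
    and "umbilics a b c = {vector [x0, y0, 0], vector [x0, -y0, 0], vector [-x0, y0, 0], vector [-x0, -y0, 0]}"
    and "card (umbilics a b c) = 4"
    and "umbilics a b c \<subseteq> sec_xy a b c"
    and "sec_xy a b c - umbilics a b c \<subseteq> ridge1 a b c \<union> ridge2 a b c"
    and "\<forall>p \<in> sec_xy a b c. \<bar>p$1\<bar> > x0 \<longrightarrow> p \<in> ridge1 a b c \<and> p \<in> beak_to_beak1 a b c"
    and "\<forall>p \<in> sec_xy a b c. \<bar>p$1\<bar> < x0 \<longrightarrow> p \<in> ridge2 a b c \<and> p \<in> beak_to_beak2 a b c"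
proof -
  have lt: "c < b" "b < 0" "0 < a" using k by (auto simp: is_two_sheets_def)
  have rng: "c \<le> croot 1 p" "croot 1 p \<le> b" "croot (- 1) p \<le> c" if "p \<in> Q" for p
    using root_range(3)[OF that k] by auto
  have "p \<in> ridge1 a b c \<and> p \<in> zigzag1 a b c" if "p \<in> sec_xz a b c" for p
  proof -
    have p: "p \<in> Q" "p$2 = 0" using that by (auto simp: sec_xz_def)
    have "croot 1 p = ax$2" using plane_iff[OF p(1), of 2] p(2) rng[OF p(1)] lt by auto
    then show ?thesis
      using zigzag1I[OF p(1), of 2] M_ax_sgn(2) rng[OF p(1)] lt by (simp add: umbilics_iff_roots_eq mult_neg_neg)
  qed
  then show "sec_xz a b c \<subseteq> ridge1 a b c" "sec_xz a b c \<subseteq> zigzag1 a b c" by blast+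
  have "b * (b - c) / (b - a) > 0"
    using lt by (intro divide_neg_neg mult_neg_pos) auto
  then show x0: "x0 > 0" and y0: "y0 > 0"
    using lt by (simp_all add: x0_def y0_def)
  have sq: "x0\<^sup>2 = a * (a - c) / (a - b)" "y0\<^sup>2 = b * (b - c) / (b - a)"
    using lt \<open>b * (b - c) / (b - a) > 0\<close> by (simp_all add: x0_def y0_def)
  have mx0: "M$1 * x0\<^sup>2 = (a - c)\<^sup>2" and my0: "M$2 * y0\<^sup>2 = (b - c)\<^sup>2"
    using lt unfolding sq M_simps by (simp_all add: power2_eq_square)
  have umb: "p \<in> umbilics a b c \<longleftrightarrow> (p$1)\<^sup>2 = x0\<^sup>2 \<and> (p$2)\<^sup>2 = y0\<^sup>2 \<and> p$3 = 0" for p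
    using umbilics_middle[of 3 p] rng M_nz
    by (auto simp: forall_3 mx0[symmetric] my0[symmetric])
  show u: "umbilics a b c = {vector [x0, y0, 0], vector [x0, -y0, 0], vector [-x0, y0, 0], vector [-x0, -y0, 0]}"
    by (auto simp: umb vec_eq_iff forall_3 power2_eq_iff)
  show "card (umbilics a b c) = 4"
    unfolding u using x0 y0 by (simp add: vec_eq_iff forall_3)
  show "umbilics a b c \<subseteq> sec_xy a b c"
    by (auto simp: umb sec_xy_def dest: umbilics_iff_roots_eq[THEN iffD1])
  show "sec_xy a b c - umbilics a b c \<subseteq> ridge1 a b c \<union> ridge2 a b c"
    using plane_subset_ridges[of _ 3] by (auto simp: sec_xy_def)
  have mid: "x0 < \<bar>p$1\<bar> \<Longrightarrow> croot 1 p = ax$3 \<and> croot (- 1) p < ax$3"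
    "\<bar>p$1\<bar> < x0 \<Longrightarrow> croot (- 1) p = ax$3 \<and> ax$3 < croot 1 p" if "p \<in> sec_xy a b c" for p
    using middle_section[of p 3 x0] that rng[of p] lt x0 mx0 M_sgn(3)[OF k] by (auto simp: sec_xy_def)
  show "\<forall>p \<in> sec_xy a b c. \<bar>p$1\<bar> > x0 \<longrightarrow> p \<in> ridge1 a b c \<and> p \<in> beak_to_beak1 a b c"
  proof (intro ballI impI)
    fix p assume p: "p \<in> sec_xy a b c" "\<bar>p$1\<bar> > x0"
    then have "p \<in> Q" by (simp add: sec_xy_def)
    then show "p \<in> ridge1 a b c \<and> p \<in> beak_to_beak1 a b c"
      using beak1I[of p 3] mid(1)[OF p] rng[of p] lt M_ax_sgn(3)
      by (simp add: umbilics_iff_roots_eq mult_pos_neg)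
  qed
  show "\<forall>p \<in> sec_xy a b c. \<bar>p$1\<bar> < x0 \<longrightarrow> p \<in> ridge2 a b c \<and> p \<in> beak_to_beak2 a b c"
  proof (intro ballI impI)
    fix p assume p: "p \<in> sec_xy a b c" "\<bar>p$1\<bar> < x0"
    then have "p \<in> Q" by (simp add: sec_xy_def)
    then show "p \<in> ridge2 a b c \<and> p \<in> beak_to_beak2 a b c"
      using beak2I[of p 3] mid(2)[OF p] rng[of p] lt M_ax_sgn(3)
      by (simp add: umbilics_iff_roots_eq mult_pos_neg)
  qed
qed

end

theorem proposition34:
  fixes a b c :: real
  assumes "is_ellipsoid a b c \<or> is_one_sheet a b c \<or> is_two_sheets a b c"
  shows
    "(ridge_set a b c = (sec_xy a b c \<union> sec_xz a b c \<union> sec_yz a b c) - umbilics a b c) \<and>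
    (is_ellipsoid a b c \<longrightarrow>
      sec_xy a b c \<subseteq> ridge2 a b c \<and> sec_xy a b c \<subseteq> zigzag2 a b c \<and>
      sec_yz a b c \<subseteq> ridge1 a b c \<and> sec_yz a b c \<subseteq> zigzag1 a b c \<and>
      (let x0 = sqrt (a * (a - b) / (a - c)); z0 = sqrt (c * (b - c) / (a - c)) in
        umbilics a b c = {vector [x0, 0, z0], vector [x0, 0, -z0],
                          vector [-x0, 0, z0], vector [-x0, 0, -z0]} \<and>
        card (umbilics a b c) = 4 \<and>
        umbilics a b c \<subseteq> sec_xz a b c \<and>
        sec_xz a b c - umbilics a b c \<subseteq> ridge1 a b c \<union> ridge2 a b c \<and>
        (\<forall>p \<in> sec_xz a b c. \<bar>p$1\<bar> > x0 \<longrightarrow> p \<in> ridge1 a b c \<and> p \<in> beak_to_beak1 a b c) \<and>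
        (\<forall>p \<in> sec_xz a b c. \<bar>p$1\<bar> < x0 \<longrightarrow> p \<in> ridge2 a b c \<and> p \<in> beak_to_beak2 a b c))) \<and>
    (is_one_sheet a b c \<longrightarrow>
      sec_yz a b c \<subseteq> ridge1 a b c \<and> sec_yz a b c \<subseteq> beak_to_beak1 a b c \<and>
      sec_xz a b c \<subseteq> ridge1 a b c \<and> sec_xz a b c \<subseteq> zigzag1 a b c \<and>
      sec_xy a b c \<subseteq> ridge2 a b c \<and> sec_xy a b c \<subseteq> zigzag2 a b c) \<and>
    (is_two_sheets a b c \<longrightarrow>
      sec_xz a b c \<subseteq> ridge1 a b c \<and> sec_xz a b c \<subseteq> zigzag1 a b c \<and>
      (\<exists>x0 y0. x0 > 0 \<and> y0 > 0 \<and>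
        umbilics a b c = {vector [x0, y0, 0], vector [x0, -y0, 0],
                          vector [-x0, y0, 0], vector [-x0, -y0, 0]} \<and>
        card (umbilics a b c) = 4 \<and>
        umbilics a b c \<subseteq> sec_xy a b c \<and>
        sec_xy a b c - umbilics a b c \<subseteq> ridge1 a b c \<union> ridge2 a b c \<and>
        (\<forall>p \<in> sec_xy a b c. \<bar>p$1\<bar> > x0 \<longrightarrow> p \<in> ridge1 a b c \<and> p \<in> beak_to_beak1 a b c) \<and>
        (\<forall>p \<in> sec_xy a b c. \<bar>p$1\<bar> < x0 \<longrightarrow> p \<in> ridge2 a b c \<and> p \<in> beak_to_beak2 a b c)))"
proof -
  interpret central_quadric a b c by unfold_locales (rule assms)
  show ?thesis
    unfolding Let_def
    \<comment> \<open>The existential over the umbilic coordinates is met by the values used in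
      \<open>two_sheets_ridges\<close>.\<close>
    by (intro conjI impI ridge_set_eq;
        (rule exI[of _ "sqrt (a * (a - c) / (a - b))"], rule exI[of _ "sqrt (b * (b - c) / (b - a))"], intro conjI)?;
        rule ellipsoid_ridges one_sheet_ridges two_sheets_ridges, assumption)
qed

end
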